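(* Let $n\ge 1$ and $\beta>n/2$, and let $\mu$ be the Cauchy probability measure $\mu(dx)=Z_\beta^{-1}(1+|x|^2)^{-\beta}\,dx$ on $\mathbb{R}^n$, where $Z_\beta$ is the normalizing constant. Then there exists a constant $C=C(\beta,n)$ such that for all smooth bounded functions $f$, $$\mathrm{Ent}_\mu(f^2)\le C\int|\nabla f(x)|^2\,(1+|x|^2)\,\log(e+|x|^2)\,d\mu(x).$$
   Context: $\mathrm{Ent}_\mu(f^2)=\int f^2\log\left(\frac{f^2}{\mu(f^2)}\right)d\mu$, where $\mu(f^2)=\int f^2\,d\mu$. The notation $|x|$ is the Euclidean norm on $\mathbb{R}^n$. *)

theory Defs
  imports "HOL-Analysis.Analysis"
begin

definition cauchy_Z :: "'n::finite itself \<Rightarrow> real \<Rightarrow> real" where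
  "cauchy_Z _ \<beta> = (\<integral>x. (1 + (norm (x :: real ^ 'n))\<^sup>2) powr (- \<beta>) \<partial>lborel)"

text \<open>A probability measure exactly when \<open>\<beta> > n/2\<close>; otherwise the normalizing
  integral diverges and \<^const>\<open>cauchy_Z\<close> takes the default value 0.\<close>

definition cauchy_measure :: "real \<Rightarrow> (real ^ 'n) measure" where
  "cauchy_measure \<beta> = density lborel
     (\<lambda>x. ennreal ((1 + (norm x)\<^sup>2) powr (- \<beta>) / cauchy_Z TYPE('n) \<beta>))"

text \<open>Used for \<open>g = f\<^sup>2\<close>. The convention \<open>0 log 0 = 0\<close> (and \<open>Ent M 0 = 0\<close>)
  holds because \<open>ln 0 = 0\<close> and division by 0 gives 0.\<close>

definition Ent :: "'a measure \<Rightarrow> ('a \<Rightarrow> real) \<Rightarrow> real" where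
  "Ent M g = (\<integral>x. g x * ln (g x / (\<integral>y. g y \<partial>M)) \<partial>M)"

text \<open>\<open>Ck k f\<close>: all iterated directional derivatives of \<open>f\<close> of order at most \<open>k\<close>
  exist and are continuous.\<close>

primrec Ck :: "nat \<Rightarrow> ('a::euclidean_space \<Rightarrow> real) \<Rightarrow> bool" where
  "Ck 0 f \<longleftrightarrow> continuous_on UNIV f"
| "Ck (Suc k) f \<longleftrightarrow> (\<forall>x. f differentiable at x) \<and> (\<forall>v. Ck k (\<lambda>x. frechet_derivative f (at x) v))"

definition smooth :: "('a::euclidean_space \<Rightarrow> real) \<Rightarrow> bool" where
  "smooth f \<longleftrightarrow> (\<forall>k. Ck k f)"

definition gradient :: "('a::euclidean_space \<Rightarrow> real) \<Rightarrow> 'a \<Rightarrow> 'a" where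
  "gradient f x = (THE D. GDERIV f x :> D)"

lemma gradient_eq:
  assumes "GDERIV f x :> D"
  shows "gradient f x = D"
proof -
  have "D' = D" if "GDERIV f x :> D'" for D'
  proof -
    have "(\<lambda>h. h \<bullet> D') = (\<lambda>h. h \<bullet> D)"
      by (rule has_derivative_unique[OF that[unfolded gderiv_def] assms[unfolded gderiv_def]])
    then have "\<forall>h. h \<bullet> D' = h \<bullet> D" by (blast dest: fun_cong)
    then show ?thesis by (simp only: vector_eq_ldot)
  qed
  then show ?thesis using assms unfolding gradient_def by (intro the_equality)
qed

end

theory Submission
  imports Defs
begin

text \<open>
  The Cauchy measure is built from independent one-dimensional Cauchy variables: if \<open>x'\<close> has
  density proportional to \<open>(1 + |x'|\<^sup>2) powr (1/2 - \<beta>)\<close> and \<open>u\<close> is independent of \<open>x'\<close> with density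
  proportional to \<open>(1 + u\<^sup>2) powr (- \<beta>)\<close>, then \<open>(x', u \<cdot> sqrt (1 + |x'|\<^sup>2))\<close> has density proportional to
  \<open>(1 + |x|\<^sup>2) powr (- \<beta>)\<close>, and \<open>1 + |x|\<^sup>2 = (1 + |x'|\<^sup>2)(1 + u\<^sup>2)\<close>. Since entropy is subadditive over
  product measures and the weight \<open>(1 + |x|\<^sup>2) ln (e + |x|\<^sup>2)\<close> absorbs the derivatives of this map, an
  induction on the number of coordinates reduces the inequality to dimension one.

  On the line, let \<open>E\<close> be the weighted energy of \<open>f\<close> and \<open>h = f - f 0\<close>. Finite energy forces the
  polynomial growth \<open>h\<^sup>2 \<le> E (1 + |x|) powr (2a)\<close> with \<open>a = 2\<beta> - 1\<close>, so the logarithm in the entropy relative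
  to the constant \<open>(f 0)\<^sup>2 + E\<close> costs only a factor \<open>ln (e + x\<^sup>2)\<close>, and the resulting quadratic
  expression in \<open>h\<close> is controlled by a weighted Hardy inequality.

  All entropies are handled through \<open>Ent g = min c. \<integral> (g ln (g/c) - g + c)\<close>, whose integrand is nonnegative;
  this is why the intermediate inequalities assert the existence of some \<open>c\<close>.
\<close>

section \<open>Weighted Hardy inequality on the half-line\<close>

definition log_weight :: "real \<Rightarrow> real \<Rightarrow> real" where
  "log_weight a x = 2 / a + ln (1 + x)"

lemma log_weight_ge: "a > 0 \<Longrightarrow> x \<ge> 0 \<Longrightarrow> 2 \<le> a * log_weight a x"
  by (simp add: log_weight_def field_simps)

lemma log_weight_pos: "a > 0 \<Longrightarrow> x \<ge> 0 \<Longrightarrow> log_weight a x > 0"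
  by (simp add: log_weight_def add_pos_nonneg)

text \<open>
  Integration by parts against the primitive \<open>- h\<^sup>2 \<Psi>\<close>, where
  \<open>\<Psi> = 2/a \<cdot> log_weight a x \<cdot> (1 + x) powr (- a)\<close>. The constant term \<open>2/a\<close> of \<^const>\<open>log_weight\<close> makes
  \<open>- \<Psi>'\<close> dominate the weight on the left-hand side.
\<close>

lemma hardy_Icc:
  fixes h h' :: "real \<Rightarrow> real"
  assumes a: "a > 0" and h0: "h 0 = 0" and R: "R \<ge> 0"
    and deriv: "\<And>x. (h has_real_derivative h' x) (at x)" and cont: "continuous_on UNIV h'"
  shows "integral {0..R} (\<lambda>x. (h x)\<^sup>2 * log_weight a x * (1 + x) powr (- 1 - a))
    \<le> 16 / a\<^sup>2 * integral {0..R} (\<lambda>x. (h' x)\<^sup>2 * log_weight a x * (1 + x) powr (1 - a))"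
proof -
  define q where "q x = (h x)\<^sup>2 * log_weight a x * (1 + x) powr (- 1 - a)" for x
  define p where "p x = (h' x)\<^sup>2 * log_weight a x * (1 + x) powr (1 - a)" for x
  define D where "D x = - (h x)\<^sup>2 * (2 / a * log_weight a x * (1 + x) powr (- a))" for x
  define D' where "D' x = (1 + x) powr (- 1 - a) *
      (- (4 / a) * h x * h' x * log_weight a x * (1 + x) + (h x)\<^sup>2 * (2 / a) * (a * log_weight a x - 1))" for x
  have conth: "continuous_on UNIV h"
    using deriv by (meson DERIV_continuous continuous_at_imp_continuous_on)
  have DD: "(D has_real_derivative D' x) (at x)" if "x \<ge> 0" for x
  proof -
    have e: "(1 + x) powr (- a) = (1 + x) * (1 + x) powr (- 1 - a)"
      using that by (simp add: powr_mult_base)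
    show ?thesis unfolding D_def log_weight_def
      apply (rule derivative_eq_intros deriv refl | use that in \<open>simp; fail\<close>)+
      using that a unfolding D'_def log_weight_def
      apply (simp add: e powr_diff powr_minus)
      apply (simp add: divide_simps)
      apply (simp add: algebra_simps power2_eq_square)
      done
  qed
  have contq: "continuous_on {0..R} q" and contp: "continuous_on {0..R} p"
    unfolding q_def p_def log_weight_def
    by (auto intro!: continuous_intros continuous_on_subset[OF conth] continuous_on_subset[OF cont])
  have int: "q integrable_on {0..R}" "p integrable_on {0..R}"
    using contq contp integrable_continuous_interval by blast+
  have hasD: "(D' has_integral (D R - D 0)) {0..R}"
    using R by (intro fundamental_theorem_of_calculus)
      (auto intro: DD has_field_derivative_at_within simp: has_real_derivative_iff_has_vector_derivative[symmetric])
  \<comment> \<open>Because \<open>log_weight a x >= 2/a\<close>, the \<open>h^2\<close> part of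
    \<open>D'\<close> is at least \<open>q\<close>. Completing the square absorbs the cross term at
    the price of half of \<open>q\<close> and \<open>8/a^2\<close> times \<open>p\<close>, whence
    the final constant \<open>16/a^2\<close>.\<close>
  have le: "q x / 2 - 8 / a\<^sup>2 * p x \<le> D' x" if x: "x \<in> {0..R}" for x
  proof -
    define y where "y = (1 + x) powr (- 1 - a)"
    define l where "l = log_weight a x"
    define k where "k = h' x * (1 + x)"
    have y: "y \<ge> 0" unfolding y_def by simp
    have l: "a * l \<ge> 2" "l > 0" using log_weight_ge log_weight_pos a x unfolding l_def by auto
    have e: "(1 + x) powr (1 - a) = (1 + x)\<^sup>2 * y"
      using x powr_add[of "1 + x" 2 "- 1 - a"] unfolding y_def by simp
    have "l * (h x)\<^sup>2 \<le> (h x)\<^sup>2 * (2 / a) * (a * l - 1)"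
    proof -
      have "l \<le> 2 / a * (a * l - 1)" using l a by (simp add: field_simps)
      from mult_left_mono[OF this, of "(h x)\<^sup>2"] show ?thesis
        by (simp only: mult.assoc mult.commute[of l] zero_le_power2 simp_thms)
    qed
    moreover have "0 \<le> l * ((h x - 4 / a * k)\<^sup>2 / 2)" using l by simp
    moreover have "l * ((h x - 4 / a * k)\<^sup>2 / 2) = l * (h x)\<^sup>2 / 2 - 4 / a * h x * k * l + 8 / a\<^sup>2 * k\<^sup>2 * l"
      using a by (simp add: power2_eq_square field_simps)
    ultimately have "l * (h x)\<^sup>2 / 2 - 8 / a\<^sup>2 * (k\<^sup>2 * l)
        \<le> - (4 / a) * h x * k * l + (h x)\<^sup>2 * (2 / a) * (a * l - 1)"
      by (simp add: mult.assoc)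
    from mult_left_mono[OF this y] show ?thesis
      unfolding D'_def q_def p_def e y_def[symmetric] l_def[symmetric] k_def
      by (simp add: algebra_simps power2_eq_square)
  qed
  have ints: "(\<lambda>x. q x / 2) integrable_on {0..R}" "(\<lambda>x. 8 / a\<^sup>2 * p x) integrable_on {0..R}"
    using integrable_on_divide[OF int(1), of 2] integrable_on_cmult_left[OF int(2), of "8 / a\<^sup>2"] by auto
  have "integral {0..R} (\<lambda>x. q x / 2 - 8 / a\<^sup>2 * p x) \<le> integral {0..R} D'"
    by (intro integral_le integrable_diff ints has_integral_integrable[OF hasD] le)
  also have "\<dots> = D R - D 0" using hasD by (rule integral_unique)
  \<comment> \<open>The boundary term at \<open>R\<close> has the favourable sign and the one at 0
    vanishes with \<open>h\<close>, so the bound is uniform in \<open>R\<close>.\<close>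
  also have "D R - D 0 \<le> 0"
    using R a log_weight_pos[of a R] h0 unfolding D_def by (simp add: mult_nonneg_nonneg)
  also have "integral {0..R} (\<lambda>x. q x / 2 - 8 / a\<^sup>2 * p x) = integral {0..R} q / 2 - 8 / a\<^sup>2 * integral {0..R} p"
    using ints by (subst integral_diff) auto
  finally show ?thesis unfolding q_def p_def by simp
qed

text \<open>In essence Cauchy-Schwarz for \<open>h R\<close> as the integral of \<open>h'\<close>,
  against the weight \<open>(1 + x) powr (1 - a)\<close>, whose reciprocal integrates to at most
  \<open>(1 + R) powr a / a\<close>. Of \<open>log_weight\<close> only the lower bound
  \<open>2/a\<close> is kept: polynomial growth is enough, since it will be seen through a
  logarithm.\<close>

lemma pointwise_growth:
  fixes h h' :: "real \<Rightarrow> real"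
  assumes a: "a > 0" and h0: "h 0 = 0" and R: "R \<ge> 0" and E: "E > 0"
    and deriv: "\<And>x. (h has_real_derivative h' x) (at x)" and cont: "continuous_on UNIV h'"
    and le: "integral {0..R} (\<lambda>x. (h' x)\<^sup>2 * log_weight a x * (1 + x) powr (1 - a)) \<le> E"
  shows "(h R)\<^sup>2 \<le> E * (1 + R) powr (2 * a)"
proof -
  define p where "p x = (h' x)\<^sup>2 * log_weight a x * (1 + x) powr (1 - a)" for x
  define s where "s = sqrt E"
  have s: "s > 0" "s * s = E" using E unfolding s_def by auto
  have contp: "continuous_on {0..R} p" and conti: "continuous_on {0..R} (\<lambda>x. (1 + x) powr (a - 1))"
    unfolding p_def log_weight_def
    by (auto intro!: continuous_intros continuous_on_subset[OF cont])
  have int: "p integrable_on {0..R}" "(\<lambda>x. (1 + x) powr (a - 1)) integrable_on {0..R}"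
    using contp conti integrable_continuous_interval by blast+
  have hasP: "((\<lambda>x. (1 + x) powr (a - 1)) has_integral ((1 + R) powr a / a - (1 + 0) powr a / a)) {0..R}"
    using R a by (intro fundamental_theorem_of_calculus)
      (auto intro!: derivative_eq_intros
            simp: has_real_derivative_iff_has_vector_derivative[symmetric])
  \<comment> \<open>Weighted arithmetic-geometric mean in place of Cauchy-Schwarz; the scale
    \<open>s = sqrt E\<close> makes both terms contribute multiples of \<open>s\<close> after
    integration.\<close>
  have pt: "\<bar>h' x\<bar> \<le> p x / (2 * s) + s * a / 4 * (1 + x) powr (a - 1)" if x: "x \<in> {0..R}" for x
  proof -
    define y where "y = (1 + x) powr (1 - a)"
    define l where "l = log_weight a x"
    have y: "y > 0" using x unfolding y_def by auto
    have l: "a * l \<ge> 2" "l > 0" using log_weight_ge log_weight_pos a x unfolding l_def by auto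
    have e: "(1 + x) powr (a - 1) = 1 / y"
      using x unfolding y_def by (simp add: powr_diff)
    have "0 \<le> (\<bar>h' x\<bar> * (l * y) - s)\<^sup>2 / (2 * s * (l * y))" using s l y by simp
    also have "\<dots> = p x / (2 * s) + s / (2 * (l * y)) - \<bar>h' x\<bar>"
    proof -
      have "(\<bar>h' x\<bar> * (l * y) - s)\<^sup>2 / (2 * s * (l * y)) = \<bar>h' x\<bar>\<^sup>2 * l * y / (2 * s) + s / (2 * (l * y)) - \<bar>h' x\<bar>"
        using s l y by (simp add: field_simps power2_eq_square)
      then show ?thesis unfolding p_def l_def y_def by simp
    qed
    finally have "\<bar>h' x\<bar> \<le> p x / (2 * s) + s / (2 * (l * y))" by simp
    also have "s / (2 * (l * y)) \<le> s * a / 4 * (1 / y)"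
      using s l y by (simp add: field_simps)
    finally show ?thesis unfolding e by simp
  qed
  have hash: "(h' has_integral (h R - h 0)) {0..R}"
    using R by (intro fundamental_theorem_of_calculus)
      (auto intro: deriv has_field_derivative_at_within simp: has_real_derivative_iff_has_vector_derivative[symmetric])
  have int': "(\<lambda>x. s * a / 4 * (1 + x) powr (a - 1)) integrable_on {0..R}"
    using integrable_on_cmult_left[OF int(2), of "s * a / 4"] by simp
  have "norm (integral {0..R} h') \<le> integral {0..R} (\<lambda>x. p x / (2 * s) + s * a / 4 * (1 + x) powr (a - 1))"
    using pt by (intro integral_norm_bound_integral integrable_add integrable_on_divide
        int(1) int' has_integral_integrable[OF hash]) auto
  also have "\<dots> = integral {0..R} p / (2 * s) + s * a / 4 * ((1 + R) powr a / a - 1 / a)"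
    using int(1) int' integral_unique[OF hasP]
    by (subst integral_add) (auto intro!: integrable_on_divide)
  also have "\<dots> \<le> E / (2 * s) + s * a / 4 * ((1 + R) powr a / a)"
    using le s a unfolding p_def by (intro add_mono divide_right_mono mult_left_mono) auto
  also have "\<dots> = s / 2 + s / 4 * (1 + R) powr a" using s a by (simp add: field_simps)
  also have "\<dots> \<le> s * (1 + R) powr a"
  proof -
    have "(1 + R) powr a \<ge> 1" using R a by (simp add: ge_one_powr_ge_zero)
    then have "s * 1 \<le> s * (1 + R) powr a" using s by (intro mult_left_mono) auto
    moreover have "s / 4 * (1 + R) powr a = s * (1 + R) powr a / 4" by simp
    ultimately show ?thesis using s by linarith
  qed
  finally have "\<bar>h R\<bar> \<le> s * (1 + R) powr a" using integral_unique[OF hash] h0 by simp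
  then have "\<bar>h R\<bar>\<^sup>2 \<le> (s * (1 + R) powr a)\<^sup>2" by (intro power_mono) auto
  also have "\<dots> = E * (1 + R) powr (2 * a)"
    using s R by (simp add: power_mult_distrib power2_eq_square[of s] powr_power mult.commute)
  finally show ?thesis by simp
qed

section \<open>Pointwise bounds for the entropy integrand\<close>

text \<open>The Bregman divergence of \<open>t ln t\<close> between \<open>t\<close> and the
  reference value \<open>c\<close>; it vanishes at \<open>t = c\<close>.\<close>

definition rel_ent :: "real \<Rightarrow> real \<Rightarrow> real" where
  "rel_ent c t = t * ln (t / c) - t + c"

lemma rel_ent_nonneg:
  assumes "t > 0" "c > 0" shows "0 \<le> rel_ent c t"
proof -
  have "ln (c / t) \<le> c / t - 1" using assms by (intro ln_le_minus_one) auto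
  then have "t * ln (c / t) \<le> t * (c / t - 1)" using assms by (intro mult_left_mono) auto
  then show ?thesis using assms by (simp add: rel_ent_def ln_div algebra_simps)
qed

text \<open>From \<open>ln s <= s - 1\<close> at \<open>s = t / c\<close>; the remaining linear
  terms complete the square.\<close>

lemma rel_ent_le_square:
  assumes "t > 0" "c > 0" shows "rel_ent c t \<le> (t - c)\<^sup>2 / c"
proof -
  have "ln (t / c) \<le> t / c - 1" using assms by (intro ln_le_minus_one) auto
  then have "t * ln (t / c) \<le> t * (t / c - 1)" using assms by (intro mult_left_mono) auto
  then show ?thesis using assms by (simp add: rel_ent_def field_simps power2_eq_square)
qed

text \<open>To be used with \<open>v = f x\<close>, \<open>b = f 0\<close>,
  \<open>c = b^2 + E\<close> and \<open>h = v - b\<close>. If \<open>v^2 <= 4 c\<close> the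
  quadratic bound applies, with \<open>v^2 - c = 2 b h + h^2 - E\<close>. Otherwise
  \<open>v <= 2 h\<close>, and the logarithm is controlled by the growth bound \<open>E * G\<close>
  together with \<open>E <= c\<close>.\<close>

lemma rel_ent_square_le:
  fixes v b :: real
  assumes v: "v > 0" and E: "E > 0" and G: "G \<ge> 1" and le: "(v - b)\<^sup>2 \<le> E * G"
  shows "rel_ent (b\<^sup>2 + E) (v\<^sup>2) \<le> 42 * (v - b)\<^sup>2 + 3 * E + 4 * (v - b)\<^sup>2 * ln (4 * G)"
proof (cases "v\<^sup>2 \<le> 4 * (b\<^sup>2 + E)")
  case True
  define c h where "c = b\<^sup>2 + E" and "h = v - b"
  have c: "c > 0" "b\<^sup>2 \<le> c" "E \<le> c" using E unfolding c_def by (auto intro: add_nonneg_pos)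
  have "(v\<^sup>2 - c)\<^sup>2 \<le> 3 * (4 * b\<^sup>2 * h\<^sup>2 + h\<^sup>2 * h\<^sup>2 + E\<^sup>2)"
  proof -
    have "v\<^sup>2 - c = 2 * b * h + h * h - E" unfolding c_def h_def by (simp add: power2_eq_square algebra_simps)
    moreover have sq: "(x + y - z)\<^sup>2 \<le> 3 * (x\<^sup>2 + y\<^sup>2 + z\<^sup>2)" for x y z :: real
    proof -
      have "3 * (x\<^sup>2 + y\<^sup>2 + z\<^sup>2) - (x + y - z)\<^sup>2 = (x - y)\<^sup>2 + (x + z)\<^sup>2 + (y + z)\<^sup>2"
        by (simp add: power2_eq_square algebra_simps)
      moreover have "(x - y)\<^sup>2 + (x + z)\<^sup>2 + (y + z)\<^sup>2 \<ge> 0" by simp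
      ultimately show ?thesis by linarith
    qed
    ultimately show ?thesis using sq[of "2 * b * h" "h * h" E] by (simp add: power_mult_distrib)
  qed
  also have "\<dots> \<le> 3 * (4 * c * h\<^sup>2 + h\<^sup>2 * (10 * c) + E * c)"
  proof -
    \<comment> \<open>With the case assumption this gives \<open>h^2 <= 8 c + 2 c\<close>, which
      lowers the quartic term to \<open>10 c h^2\<close>; the constant 42 is
      \<open>3 * (4 + 10)\<close>.\<close>
    have "h\<^sup>2 \<le> 2 * v\<^sup>2 + 2 * b\<^sup>2"
    proof -
      have "2 * v\<^sup>2 + 2 * b\<^sup>2 - h\<^sup>2 = (v + b)\<^sup>2" unfolding h_def by (simp add: power2_eq_square algebra_simps)
      then show ?thesis by (smt (verit) zero_le_power2)
    qed
    then have "h\<^sup>2 \<le> 10 * c" using True c unfolding c_def by auto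
    then show ?thesis using c E
      by (intro mult_left_mono add_mono mult_mono) (auto simp: power2_eq_square)
  qed
  also have "\<dots> = (42 * h\<^sup>2 + 3 * E) * c" by (simp add: algebra_simps)
  finally have "(v\<^sup>2 - c)\<^sup>2 / c \<le> 42 * h\<^sup>2 + 3 * E" using c by (simp add: field_simps)
  moreover have "0 \<le> 4 * h\<^sup>2 * ln (4 * G)" using G by simp
  ultimately show ?thesis
    using rel_ent_le_square[of "v\<^sup>2" c] v c unfolding h_def c_def by simp
next
  case False
  define c h where "c = b\<^sup>2 + E" and "h = v - b"
  have c: "c > 0" "b\<^sup>2 \<le> c" "E \<le> c" using E unfolding c_def by (auto intro: add_nonneg_pos)
  have gt: "4 * c < v\<^sup>2" using False unfolding c_def by simp
  \<comment> \<open>Since \<open>v\<close> is at least twice \<open>|b|\<close>, the increment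
    \<open>h\<close> carries at least half of \<open>v\<close>.\<close>
  have "(2 * \<bar>b\<bar>)\<^sup>2 \<le> v\<^sup>2" using gt c by (simp add: power_mult_distrib)
  then have "2 * \<bar>b\<bar> \<le> v" using v abs_le_square_iff[of "2 * \<bar>b\<bar>" v] by simp
  then have "v / 2 \<le> h" unfolding h_def by simp
  then have "(v / 2)\<^sup>2 \<le> h\<^sup>2" using v by (intro power_mono) auto
  then have vh: "v\<^sup>2 \<le> 4 * h\<^sup>2" by (simp add: power_divide)
  have "v\<^sup>2 / c \<le> 4 * G"
  proof -
    have "v\<^sup>2 \<le> 4 * (E * G)" using vh le unfolding h_def by simp
    also have "\<dots> \<le> 4 * (c * G)" using c G by (intro mult_left_mono mult_right_mono) auto
    finally show ?thesis using c by (simp add: field_simps)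
  qed
  then have l: "ln (v\<^sup>2 / c) \<le> ln (4 * G)" using v c G by (intro ln_le_cancel_iff[THEN iffD2]) auto
  have l0: "0 \<le> ln (4 * G)" using G by simp
  have "rel_ent c (v\<^sup>2) \<le> v\<^sup>2 * ln (v\<^sup>2 / c)" using gt c unfolding rel_ent_def by simp
  also have "\<dots> \<le> v\<^sup>2 * ln (4 * G)" using l by (intro mult_left_mono) auto
  also have "\<dots> \<le> 4 * h\<^sup>2 * ln (4 * G)" using vh l0 by (intro mult_right_mono) auto
  also have "\<dots> \<le> 42 * h\<^sup>2 + 3 * E + 4 * h\<^sup>2 * ln (4 * G)" using E by simp
  finally show ?thesis unfolding c_def h_def .
qed

section \<open>The one-dimensional inequality\<close>

text \<open>Monotone convergence along \<open>[0, n]\<close>. It carries the estimates on compact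
  intervals, obtained from the fundamental theorem of calculus, over to the half-line.\<close>

lemma nn_integral_atLeast_le:
  fixes F :: "real \<Rightarrow> ennreal"
  assumes [measurable]: "F \<in> borel_measurable borel"
    and le: "\<And>n::nat. (\<integral>\<^sup>+x. F x * indicator {0..real n} x \<partial>lborel) \<le> B"
  shows "(\<integral>\<^sup>+x. F x * indicator {0..} x \<partial>lborel) \<le> B"
proof -
  have "(SUP n. F x * indicator {0..real n} x) = F x * indicator {0..} x" for x
  proof (rule antisym)
    show "F x * indicator {0..} x \<le> (SUP n. F x * indicator {0..real n} x)"
      by (rule SUP_upper2[of "nat \<lceil>x\<rceil>"]) (auto split: split_indicator simp: of_nat_nat)
  qed (auto intro!: SUP_least split: split_indicator)
  then have "(\<integral>\<^sup>+x. F x * indicator {0..} x \<partial>lborel) = (\<integral>\<^sup>+x. (SUP n. F x * indicator {0..real n} x) \<partial>lborel)"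
    by simp
  also have "\<dots> = (SUP n. \<integral>\<^sup>+x. F x * indicator {0..real n} x \<partial>lborel)"
    by (intro nn_integral_monotone_convergence_SUP)
      (auto simp: incseq_def le_fun_def split: split_indicator)
  also have "\<dots> \<le> B" using le by (rule SUP_least)
  finally show ?thesis .
qed

lemma nn_integral_le_reflect:
  fixes F :: "real \<Rightarrow> ennreal"
  assumes [measurable]: "F \<in> borel_measurable borel"
  shows "(\<integral>\<^sup>+x. F x \<partial>lborel)
    \<le> (\<integral>\<^sup>+x. F x * indicator {0..} x \<partial>lborel) + (\<integral>\<^sup>+x. F (- x) * indicator {0..} x \<partial>lborel)"
proof -
  have "(\<integral>\<^sup>+x. F x \<partial>lborel) \<le> (\<integral>\<^sup>+x. F x * indicator {0..} x + F x * indicator {..0} x \<partial>lborel)"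
    by (intro nn_integral_mono) (auto split: split_indicator)
  also have "\<dots> = (\<integral>\<^sup>+x. F x * indicator {0..} x \<partial>lborel) + (\<integral>\<^sup>+x. F x * indicator {..0} x \<partial>lborel)"
    by (intro nn_integral_add) auto
  also have "(\<integral>\<^sup>+x. F x * indicator {..0} x \<partial>lborel) = (\<integral>\<^sup>+x. F (- x) * indicator {0..} x \<partial>lborel)"
    by (subst nn_integral_real_affine[where c = "-1" and t = 0])
      (auto intro!: nn_integral_cong split: split_indicator)
  finally show ?thesis .
qed

text \<open>Bridge from the Lebesgue energy on the half-line to the gauge integrals over intervals
  that occur in \<open>hardy_Icc\<close> and \<open>pointwise_growth\<close>.\<close>

lemma half_line_energy_Icc:
  fixes f' :: "real \<Rightarrow> real"
  assumes a: "a > 0" and E: "E > 0" and cont: "continuous_on UNIV f'"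
    and le: "(\<integral>\<^sup>+x. ennreal ((f' x)\<^sup>2 * log_weight a x * (1 + x) powr (1 - a)) * indicator {0..} x \<partial>lborel) \<le> ennreal E"
  shows "integral {0..R} (\<lambda>x. (f' x)\<^sup>2 * log_weight a x * (1 + x) powr (1 - a)) \<le> E"
proof -
  define p where "p x = (f' x)\<^sup>2 * log_weight a x * (1 + x) powr (1 - a)" for x
  have "continuous_on {0..R} p"
    unfolding p_def log_weight_def by (auto intro!: continuous_intros continuous_on_subset[OF cont])
  then have "(p has_integral (integral {0..R} p)) {0..R}"
    by (intro integrable_integral integrable_continuous_interval)
  moreover have "0 \<le> p x" if "x \<in> {0..R}" for x
    using log_weight_pos[OF a, of x] that unfolding p_def by simp
  ultimately have "ennreal (integral {0..R} p) = (\<integral>\<^sup>+x. ennreal (p x) * indicator {0..R} x \<partial>lborel)"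
    by (rule nn_integral_has_integral_lebesgue'[symmetric, rotated])
  also have "\<dots> \<le> (\<integral>\<^sup>+x. ennreal (p x) * indicator {0..} x \<partial>lborel)"
    by (intro nn_integral_mono) (auto split: split_indicator)
  also have "\<dots> \<le> ennreal E" using le unfolding p_def .
  finally show ?thesis using E unfolding p_def by (simp add: ennreal_le_iff)
qed

text \<open>\<open>pointwise_growth\<close> supplies \<open>G = (1 + x) powr (2 * a)\<close> for
  \<open>rel_ent_square_le\<close>. The logarithm of \<open>4 * G\<close> is of the order of
  \<open>log_weight\<close>, exactly the weight that \<open>hardy_Icc\<close> controls. The
  reference value depends on \<open>f 0\<close> and \<open>E\<close> only, so the reflected
  half-line can use the same one.\<close>

lemma rel_ent_half_line:
  fixes f f' :: "real \<Rightarrow> real"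
  assumes a: "a > 0" and E: "E > 0" and pos: "\<And>x. f x > 0"
    and deriv: "\<And>x. (f has_real_derivative f' x) (at x)" and cont: "continuous_on UNIV f'"
    and le: "(\<integral>\<^sup>+x. ennreal ((f' x)\<^sup>2 * log_weight a x * (1 + x) powr (1 - a)) * indicator {0..} x \<partial>lborel) \<le> ennreal E"
  shows "(\<integral>\<^sup>+x. ennreal (rel_ent ((f 0)\<^sup>2 + E) ((f x)\<^sup>2) * (1 + x) powr (- 1 - a)) * indicator {0..} x \<partial>lborel)
    \<le> ennreal (467 / a * E)"
proof (rule nn_integral_atLeast_le)
  have contf: "continuous_on UNIV f"
    using deriv by (meson DERIV_continuous continuous_at_imp_continuous_on)
  have [measurable]: "f \<in> borel_measurable borel"
    using contf by (rule borel_measurable_continuous_onI)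
  show "(\<lambda>x. ennreal (rel_ent ((f 0)\<^sup>2 + E) ((f x)\<^sup>2) * (1 + x) powr (- 1 - a))) \<in> borel_measurable borel"
    unfolding rel_ent_def by measurable
  fix n :: nat
  define R where "R = real n"
  have R: "R \<ge> 0" unfolding R_def by simp
  define h where "h x = f x - f 0" for x
  define q where "q x = (h x)\<^sup>2 * log_weight a x * (1 + x) powr (- 1 - a)" for x
  define y where "y x = (1 + x) powr (- 1 - a)" for x
  have dh: "(h has_real_derivative f' x) (at x)" for x
    unfolding h_def by (auto intro!: derivative_eq_intros deriv)
  note en = half_line_energy_Icc[OF a E cont le]
  have "continuous_on {0..R} q"
    unfolding q_def log_weight_def h_def by (auto intro!: continuous_intros continuous_on_subset[OF contf])
  then have hq: "(q has_integral (integral {0..R} q)) {0..R}"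
    by (intro integrable_integral integrable_continuous_interval)
  have hy: "(y has_integral (- ((1 + R) powr (- a)) / a - (- ((1 + 0) powr (- a)) / a))) {0..R}"
  proof (rule fundamental_theorem_of_calculus[OF R])
    fix x assume "x \<in> {0..R}"
    then have "((\<lambda>x. (1 + x) powr (- a)) has_real_derivative - a * (1 + x) powr (- a - 1) * 1) (at x)"
      by (intro DERIV_chain2[OF has_real_derivative_powr]) (auto intro!: derivative_eq_intros)
    from DERIV_cdivide[OF DERIV_minus[OF this], of a]
    have "((\<lambda>x. - ((1 + x) powr (- a)) / a) has_real_derivative y x) (at x)"
      using a arg_cong[of "- a - 1" "- 1 - a" "(powr) (1 + x)"] by (simp add: y_def)
    then show "((\<lambda>x. - ((1 + x) powr (- a)) / a) has_vector_derivative y x) (at x within {0..R})"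
      by (auto intro: has_field_derivative_at_within simp: has_real_derivative_iff_has_vector_derivative[symmetric])
  qed
  have "(h R)\<^sup>2 \<le> E * (1 + R) powr (2 * a)" if "R \<ge> 0" for R
    using pointwise_growth[OF a _ that E dh cont en] unfolding h_def by simp
  note growth = this
  have pt: "rel_ent ((f 0)\<^sup>2 + E) ((f x)\<^sup>2) * y x \<le> 29 * a * q x + 3 * E * y x" if x: "x \<ge> 0" for x
  proof -
    define l where "l = log_weight a x"
    have l: "a * l \<ge> 2" "l > 0" using log_weight_ge log_weight_pos a x unfolding l_def by auto
    have "rel_ent ((f 0)\<^sup>2 + E) ((f x)\<^sup>2)
        \<le> 42 * (h x)\<^sup>2 + 3 * E + 4 * (h x)\<^sup>2 * ln (4 * (1 + x) powr (2 * a))"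
      unfolding h_def using pos E growth[OF x] x a
      by (intro rel_ent_square_le) (auto simp: h_def ge_one_powr_ge_zero)
    \<comment> \<open>\<open>a * l >= 2\<close> turns 42 into \<open>21 a l\<close>, and
      \<open>ln 4 <= 4\<close> is swallowed by the constant \<open>2/a\<close> in \<open>l\<close>.
      Together this is \<open>21 + 4 * 2 = 29\<close>.\<close>
    also have "\<dots> \<le> 21 * (a * l) * (h x)\<^sup>2 + 3 * E + 4 * (h x)\<^sup>2 * (2 * a * l)"
    proof (intro add_mono mult_right_mono mult_left_mono)
      have "ln (4 * (1 + x) powr (2 * a)) = ln 4 + 2 * a * ln (1 + x)"
        using x by (simp add: ln_mult ln_powr)
      also have "ln (4::real) \<le> 4" using ln_le_minus_one[of "4::real"] by simp
      also have "4 + 2 * a * ln (1 + x) = 2 * a * l"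
        using a unfolding l_def log_weight_def by (simp add: field_simps)
      finally show "ln (4 * (1 + x) powr (2 * a)) \<le> 2 * a * l" by simp
    qed (use l E in auto)
    also have "\<dots> = 29 * a * ((h x)\<^sup>2 * l) + 3 * E" by (simp add: algebra_simps)
    finally have "rel_ent ((f 0)\<^sup>2 + E) ((f x)\<^sup>2) * y x \<le> (29 * a * ((h x)\<^sup>2 * l) + 3 * E) * y x"
      by (rule mult_right_mono) (simp add: y_def)
    then show ?thesis unfolding q_def y_def l_def by (simp add: algebra_simps)
  qed
  have "(\<integral>\<^sup>+x. ennreal (rel_ent ((f 0)\<^sup>2 + E) ((f x)\<^sup>2) * (1 + x) powr (- 1 - a)) * indicator {0..real n} x \<partial>lborel)
      \<le> (\<integral>\<^sup>+x. ennreal (29 * a * q x + 3 * E * y x) * indicator {0..R} x \<partial>lborel)"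
    using pt by (intro nn_integral_mono) (auto split: split_indicator intro!: ennreal_leI simp: R_def y_def)
  also have "\<dots> = ennreal (29 * a * integral {0..R} q
      + 3 * E * (- ((1 + R) powr (- a)) / a - (- ((1 + 0) powr (- a)) / a)))"
  proof (intro nn_integral_has_integral_lebesgue' has_integral_add has_integral_mult_right hq hy)
    show "0 \<le> 29 * a * q x + 3 * E * y x" if "x \<in> {0..R}" for x
      using a E log_weight_pos[OF a, of x] that unfolding q_def y_def by auto
  qed
  also have "\<dots> \<le> ennreal (467 / a * E)"
  proof (rule ennreal_leI)
    have "integral {0..R} q \<le> 16 / a\<^sup>2 * integral {0..R} (\<lambda>x. (f' x)\<^sup>2 * log_weight a x * (1 + x) powr (1 - a))"
      unfolding q_def by (rule hardy_Icc[OF a _ R dh cont]) (simp add: h_def)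
    also have "\<dots> \<le> 16 / a\<^sup>2 * E" using en by (intro mult_left_mono) auto
    finally have "29 * a * integral {0..R} q \<le> 29 * a * (16 / a\<^sup>2 * E)" using a by (intro mult_left_mono) auto
    also have "\<dots> = 464 / a * E" using a by (simp add: power2_eq_square)
    finally have 1: "29 * a * integral {0..R} q \<le> 464 / a * E" .
    \<comment> \<open>The weight \<open>y\<close> has mass at most \<open>1/a\<close>; the total is
      \<open>29 * 16 + 3 = 467\<close> over \<open>a\<close>.\<close>
    have "3 * E * (- ((1 + R) powr (- a)) / a - (- ((1 + 0) powr (- a)) / a)) \<le> 3 * E * (1 / a)"
      using a E R by (intro mult_left_mono) (auto simp: divide_simps)
    moreover have "467 / a * E = 464 / a * E + 3 * E * (1 / a)" using a by (simp add: field_simps)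
    ultimately show "29 * a * integral {0..R} q + 3 * E * (- ((1 + R) powr (- a)) / a - (- ((1 + 0) powr (- a)) / a))
        \<le> 467 / a * E" using 1 by linarith
  qed
  finally show "(\<integral>\<^sup>+x. ennreal (rel_ent ((f 0)\<^sup>2 + E) ((f x)\<^sup>2) * (1 + x) powr (- 1 - a)) * indicator {0..real n} x \<partial>lborel)
    \<le> ennreal (467 / a * E)" .
qed

section \<open>Comparison of powers of \<open>1 + |x|\<close> and \<open>1 + x^2\<close>\<close>

lemma one_plus_abs_square_bounds:
  fixes x :: real
  shows "1 + x\<^sup>2 \<le> (1 + \<bar>x\<bar>)\<^sup>2" "(1 + \<bar>x\<bar>)\<^sup>2 \<le> 2 * (1 + x\<^sup>2)"
proof -
  show "1 + x\<^sup>2 \<le> (1 + \<bar>x\<bar>)\<^sup>2" by (simp add: power2_sum)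
  have "0 \<le> (1 - \<bar>x\<bar>)\<^sup>2" by simp
  then show "(1 + \<bar>x\<bar>)\<^sup>2 \<le> 2 * (1 + x\<^sup>2)" by (simp add: power2_sum power2_diff)
qed

lemma powr_abs_square:
  fixes x :: real shows "(1 + \<bar>x\<bar>) powr (2 * s) = ((1 + \<bar>x\<bar>)\<^sup>2) powr s"
proof -
  have "(1 + \<bar>x\<bar>) powr 2 = (1 + \<bar>x\<bar>)\<^sup>2" by (subst powr_numeral) auto
  then show ?thesis using powr_powr[of "1 + \<bar>x\<bar>" 2 s] by simp
qed

lemma cauchy_density_le:
  fixes x :: real
  assumes "x \<ge> 0" "\<beta> \<ge> 0"
  shows "(1 + x\<^sup>2) powr (- \<beta>) \<le> 2 powr \<beta> * (1 + x) powr (- (2 * \<beta>))"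
proof -
  have "((1 + x)\<^sup>2 / 2) powr (- \<beta>) \<ge> (1 + x\<^sup>2) powr (- \<beta>)"
    using one_plus_abs_square_bounds[of x] assms by (intro powr_mono2') auto
  moreover have "((1 + x)\<^sup>2 / 2) powr (- \<beta>) = 2 powr \<beta> * (1 + x) powr (- (2 * \<beta>))"
    using assms powr_abs_square[of x "- \<beta>"] by (simp add: powr_divide powr_minus field_simps)
  ultimately show ?thesis by simp
qed

text \<open>The half-line estimate is applied to \<open>f\<close> and to its reflection. Both have
  the same value at 0 and the same energy, so one \<open>c\<close> serves both sides and the two
  bounds add.\<close>

lemma one_dim_cauchy_lsi:
  fixes \<beta> :: real
  assumes \<beta>: "\<beta> > 1 / 2"
  shows "\<exists>C>0. \<forall>f f'. (\<forall>x. f x > 0) \<longrightarrow> (\<forall>x. (f has_real_derivative f' x) (at x)) \<longrightarrow> continuous_on UNIV f' \<longrightarrow>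
    (\<exists>c>0. (\<integral>\<^sup>+x. ennreal (rel_ent c ((f x)\<^sup>2) * (1 + x\<^sup>2) powr (- \<beta>)) \<partial>lborel)
      \<le> ennreal C * (\<integral>\<^sup>+x. ennreal ((f' x)\<^sup>2 * ((1 + x\<^sup>2) * ln (exp 1 + x\<^sup>2)) * (1 + x\<^sup>2) powr (- \<beta>)) \<partial>lborel))"
proof -
  \<comment> \<open>With this choice \<open>(1 + x) powr (- 1 - a)\<close> has exponent
    \<open>- 2 * \<beta>\<close> and is comparable to the Cauchy density.\<close>
  define a where "a = 2 * \<beta> - 1"
  have a: "a > 0" using \<beta> unfolding a_def by simp
  define K where "K = 2 * (2 / a + 1)"
  have K: "K > 0" using a unfolding K_def by (auto intro: add_pos_pos)
  define B where "B = 2 powr \<beta> * (467 / a)"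
  have B: "B > 0" using a unfolding B_def by simp
  define w where "w x = (1 + x\<^sup>2) * ln (exp 1 + x\<^sup>2) * (1 + x\<^sup>2) powr (- \<beta>)" for x :: real
  have w_sym: "w (- x) = w x" for x unfolding w_def by simp
  \<comment> \<open>\<open>1 + x <= e + x^2\<close> compares the logarithms, and
    \<open>1 <= ln (e + x^2)\<close> absorbs the additive constant \<open>2/a\<close>.\<close>
  have wK: "log_weight a x * (1 + x) powr (1 - a) \<le> K * w x" if x: "x \<ge> 0" for x
  proof -
    have "ln (1 + x) \<le> ln (exp 1 + x\<^sup>2)"
    proof -
      have "0 \<le> (x - 1 / 2)\<^sup>2" by simp
      moreover have "2 \<le> exp (1::real)" using exp_ge_add_one_self[of "1::real"] by simp
      ultimately have "1 + x \<le> exp 1 + x\<^sup>2" by (simp add: power2_eq_square algebra_simps)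
      then show ?thesis using x by simp
    qed
    moreover have ln1: "1 \<le> ln (exp 1 + x\<^sup>2)"
      by (subst ln_ge_iff) (auto intro: add_pos_nonneg)
    then have "2 / a * 1 \<le> 2 / a * ln (exp 1 + x\<^sup>2)" using a by (intro mult_left_mono) auto
    ultimately have 1: "log_weight a x \<le> (2 / a + 1) * ln (exp 1 + x\<^sup>2)"
      unfolding log_weight_def by (simp add: algebra_simps)
    have "(1 + x) powr (1 - a) = (1 + x)\<^sup>2 * (1 + x) powr (2 * (- \<beta>))"
      using x powr_add[of "1 + x" 2 "2 * (- \<beta>)"] unfolding a_def by simp
    also have "\<dots> = (1 + x)\<^sup>2 * ((1 + x)\<^sup>2) powr (- \<beta>)" using powr_abs_square[of x "- \<beta>"] x by simp
    also have "\<dots> \<le> 2 * (1 + x\<^sup>2) * (1 + x\<^sup>2) powr (- \<beta>)"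
      using one_plus_abs_square_bounds[of x] x \<beta>
      by (intro mult_mono powr_mono2') (auto intro: add_pos_nonneg)
    finally have 2: "(1 + x) powr (1 - a) \<le> 2 * (1 + x\<^sup>2) * (1 + x\<^sup>2) powr (- \<beta>)" .
    have "log_weight a x * (1 + x) powr (1 - a)
        \<le> (2 / a + 1) * ln (exp 1 + x\<^sup>2) * (2 * (1 + x\<^sup>2) * (1 + x\<^sup>2) powr (- \<beta>))"
      using ln1 a by (intro mult_mono 1 2) (auto intro: add_nonneg_nonneg)
    also have "\<dots> = K * w x" unfolding K_def w_def by (simp add: algebra_simps)
    finally show ?thesis .
  qed
  have wpos: "w x \<ge> 0" for x
  proof -
    have "0 \<le> ln (exp 1 + x\<^sup>2)" by (intro ln_ge_zero) (simp add: add_increasing2)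
    then show ?thesis unfolding w_def by simp
  qed
  \<comment> \<open>Stated for every positive upper bound \<open>J\<close> of the energy, not only
    for the energy itself: zero energy is treated with arbitrarily small \<open>J\<close>.\<close>
  have half: "(\<integral>\<^sup>+x. ennreal (rel_ent ((f 0)\<^sup>2 + K * J) ((f x)\<^sup>2) * (1 + x\<^sup>2) powr (- \<beta>)) * indicator {0..} x \<partial>lborel)
      \<le> ennreal (B * K * J)" (is "?A")
    and growth: "\<forall>x\<ge>0. (f x - f 0)\<^sup>2 \<le> K * J * (1 + x) powr (2 * a)" (is "?B")
    if pos: "\<And>x. f x > 0" and deriv: "\<And>x. (f has_real_derivative f' x) (at x)"
      and cont: "continuous_on UNIV f'" and J: "J > 0"
      and le: "(\<integral>\<^sup>+x. ennreal ((f' x)\<^sup>2 * w x) \<partial>lborel) \<le> ennreal J" for f f' J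
  proof -
    have KJ: "K * J > 0" using K J by simp
    have [measurable]: "f \<in> borel_measurable borel" "f' \<in> borel_measurable borel"
      using deriv cont by (auto intro!: borel_measurable_continuous_onI)
        (meson DERIV_continuous continuous_at_imp_continuous_on)
    have "(\<integral>\<^sup>+x. ennreal ((f' x)\<^sup>2 * log_weight a x * (1 + x) powr (1 - a)) * indicator {0..} x \<partial>lborel)
        \<le> (\<integral>\<^sup>+x. ennreal K * ennreal ((f' x)\<^sup>2 * w x) \<partial>lborel)"
    proof (intro nn_integral_mono)
      fix x
      have "(f' x)\<^sup>2 * (log_weight a x * (1 + x) powr (1 - a)) \<le> (f' x)\<^sup>2 * (K * w x)" if "x \<ge> 0"
        using wK[OF that] by (intro mult_left_mono) auto
      then show "ennreal ((f' x)\<^sup>2 * log_weight a x * (1 + x) powr (1 - a)) * indicator {0..} x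
          \<le> ennreal K * ennreal ((f' x)\<^sup>2 * w x)"
        using K wpos[of x] by (auto simp: ennreal_mult'[symmetric] mult_ac intro!: ennreal_leI split: split_indicator)
    qed
    also have "\<dots> = ennreal K * (\<integral>\<^sup>+x. ennreal ((f' x)\<^sup>2 * w x) \<partial>lborel)"
      by (intro nn_integral_cmult) (simp add: w_def)
    also have "\<dots> \<le> ennreal K * ennreal J" using le by (rule mult_left_mono) simp
    also have "\<dots> = ennreal (K * J)" using K by (simp add: ennreal_mult')
    finally have en: "(\<integral>\<^sup>+x. ennreal ((f' x)\<^sup>2 * log_weight a x * (1 + x) powr (1 - a)) * indicator {0..} x \<partial>lborel)
      \<le> ennreal (K * J)" .
    show ?B
      using pointwise_growth[OF a _ _ KJ _ cont half_line_energy_Icc[OF a KJ cont en], of "\<lambda>x. f x - f 0"]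
      by (simp add: DERIV_diff[OF deriv DERIV_const, simplified])
    have "(\<integral>\<^sup>+x. ennreal (rel_ent ((f 0)\<^sup>2 + K * J) ((f x)\<^sup>2) * (1 + x\<^sup>2) powr (- \<beta>)) * indicator {0..} x \<partial>lborel)
      \<le> (\<integral>\<^sup>+x. ennreal (2 powr \<beta>) * (ennreal (rel_ent ((f 0)\<^sup>2 + K * J) ((f x)\<^sup>2) * (1 + x) powr (- 1 - a)) * indicator {0..} x) \<partial>lborel)"
    proof (intro nn_integral_mono)
      fix x
      have r: "0 \<le> rel_ent ((f 0)\<^sup>2 + K * J) ((f x)\<^sup>2)"
        using pos KJ by (intro rel_ent_nonneg) (auto intro: add_nonneg_pos simp: less_imp_neq[THEN not_sym])
      then have "rel_ent ((f 0)\<^sup>2 + K * J) ((f x)\<^sup>2) * (1 + x\<^sup>2) powr (- \<beta>)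
         \<le> rel_ent ((f 0)\<^sup>2 + K * J) ((f x)\<^sup>2) * (2 powr \<beta> * (1 + x) powr (- 1 - a))" if "x \<ge> 0"
        using cauchy_density_le[OF that, of \<beta>] \<beta>
        by (intro mult_left_mono) (auto simp: a_def)
      then show "ennreal (rel_ent ((f 0)\<^sup>2 + K * J) ((f x)\<^sup>2) * (1 + x\<^sup>2) powr (- \<beta>)) * indicator {0..} x
        \<le> ennreal (2 powr \<beta>) * (ennreal (rel_ent ((f 0)\<^sup>2 + K * J) ((f x)\<^sup>2) * (1 + x) powr (- 1 - a)) * indicator {0..} x)"
        by (auto simp: ennreal_mult'[symmetric] mult_ac intro!: ennreal_leI split: split_indicator)
    qed
    also have "\<dots> = ennreal (2 powr \<beta>) * (\<integral>\<^sup>+x. ennreal (rel_ent ((f 0)\<^sup>2 + K * J) ((f x)\<^sup>2) * (1 + x) powr (- 1 - a)) * indicator {0..} x \<partial>lborel)"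
      by (intro nn_integral_cmult) (simp add: rel_ent_def)
    also have "\<dots> \<le> ennreal (2 powr \<beta>) * ennreal (467 / a * (K * J))"
      by (intro mult_left_mono rel_ent_half_line[OF a KJ pos deriv cont en]) simp
    also have "\<dots> = ennreal (B * K * J)" unfolding B_def by (simp add: ennreal_mult'[symmetric] mult_ac)
    finally show ?A .
  qed
  have main: "\<exists>c>0. (\<integral>\<^sup>+x. ennreal (rel_ent c ((f x)\<^sup>2) * (1 + x\<^sup>2) powr (- \<beta>)) \<partial>lborel)
      \<le> ennreal (2 * B * K) * (\<integral>\<^sup>+x. ennreal ((f' x)\<^sup>2 * w x) \<partial>lborel)"
    if pos: "\<And>x. f x > 0" and deriv: "\<And>x. (f has_real_derivative f' x) (at x)"
      and cont: "continuous_on UNIV f'" for f f'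
  proof -
    define J where "J = (\<integral>\<^sup>+x. ennreal ((f' x)\<^sup>2 * w x) \<partial>lborel)"
    have [measurable]: "f \<in> borel_measurable borel" "f' \<in> borel_measurable borel"
      using deriv cont by (auto intro!: borel_measurable_continuous_onI)
        (meson DERIV_continuous continuous_at_imp_continuous_on)
    define g g' where "g x = f (- x)" and "g' x = - f' (- x)" for x
    have gpos: "g x > 0" for x unfolding g_def by (rule pos)
    have gderiv: "(g has_real_derivative g' x) (at x)" for x
      unfolding g_def g'_def using DERIV_mirror[of f "f' (- x)" "- x"] deriv[of "- x"]
      by (simp add: DERIV_mirror)
    have gcont: "continuous_on UNIV g'"
      unfolding g'_def by (intro continuous_intros continuous_on_compose2[OF cont]) auto
    have "(\<integral>\<^sup>+x. ennreal ((g' x)\<^sup>2 * w x) \<partial>lborel) = (\<integral>\<^sup>+x. ennreal ((f' x)\<^sup>2 * w x) \<partial>lborel)"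
      unfolding g'_def
      by (subst (2) nn_integral_real_affine[where c = "-1" and t = 0]) (auto simp: w_sym w_def)
    then have gJ: "(\<integral>\<^sup>+x. ennreal ((g' x)\<^sup>2 * w x) \<partial>lborel) = J" unfolding J_def .
    \<comment> \<open>Infinite energy makes every \<open>c\<close> work. Zero energy is separate
      because \<open>half\<close> requires \<open>J > 0\<close>; there \<open>f\<close> turns out to
      be constant and \<open>c = (f 0)^2\<close> gives entropy 0.\<close>
    consider "J = \<infinity>" | "J = 0" | r where "J = ennreal r" "r > 0"
      by (cases J) (auto simp: less_le)
    then show ?thesis
    proof cases
      case 1
      then have "ennreal (2 * B * K) * J = \<infinity>" using B K by (simp add: ennreal_mult_top)
      then show ?thesis unfolding J_def[symmetric] by (intro exI[of _ 1]) simp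
    next
      case 2
      have const: "h x = h 0" if "\<And>x. h x > 0" "\<And>x. (h has_real_derivative h' x) (at x)" "continuous_on UNIV h'"
        "(\<integral>\<^sup>+x. ennreal ((h' x)\<^sup>2 * w x) \<partial>lborel) = 0" "x \<ge> 0" for h h' x
      proof (rule ccontr)
        assume ne: "h x \<noteq> h 0"
        define G where "G = K * (1 + x) powr (2 * a)"
        have G: "G > 0" using K \<open>x \<ge> 0\<close> unfolding G_def by simp
        \<comment> \<open>Chosen so that the growth bound with \<open>J = e\<close> is half of the
          quantity it bounds.\<close>
        define e where "e = (h x - h 0)\<^sup>2 / (2 * G)"
        have e: "e > 0" using ne G unfolding e_def by simp
        have "(h x - h 0)\<^sup>2 \<le> K * e * (1 + x) powr (2 * a)"
          using growth[OF that(1-3) e] that(4,5) by simp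
        also have "\<dots> = e * G" unfolding G_def by simp
        also have "\<dots> = (h x - h 0)\<^sup>2 / 2" using G unfolding e_def by simp
        finally show False using ne by simp
      qed
      have fc: "f x = f 0" for x
      proof (cases "x \<ge> 0")
        case True
        show ?thesis by (rule const[OF pos deriv cont]) (use True 2 J_def in auto)
      next
        case False
        have "g (- x) = g 0" by (rule const[OF gpos gderiv gcont]) (use False 2 gJ in auto)
        then show ?thesis unfolding g_def by simp
      qed
      have "rel_ent ((f 0)\<^sup>2) ((f 0)\<^sup>2) = 0"
        using pos[of 0] by (simp add: rel_ent_def)
      then have "rel_ent ((f 0)\<^sup>2) ((f x)\<^sup>2) = 0" for x
        using fc[of x] by simp
      then show ?thesis using pos[of 0] by (intro exI[of _ "(f 0)\<^sup>2"]) auto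
    next
      case 3
      define c where "c = (f 0)\<^sup>2 + K * r"
      have c: "c > 0" using K 3 unfolding c_def by (auto intro: add_nonneg_pos)
      define F where "F x = ennreal (rel_ent c ((f x)\<^sup>2) * (1 + x\<^sup>2) powr (- \<beta>))" for x
      have [measurable]: "F \<in> borel_measurable borel" unfolding F_def rel_ent_def by measurable
      have f: "(\<integral>\<^sup>+x. F x * indicator {0..} x \<partial>lborel) \<le> ennreal (B * K * r)"
        unfolding F_def c_def using half[OF pos deriv cont 3(2)] 3(1) unfolding J_def by simp
      have g: "(\<integral>\<^sup>+x. F (- x) * indicator {0..} x \<partial>lborel) \<le> ennreal (B * K * r)"
        unfolding F_def c_def using half[OF gpos gderiv gcont 3(2)] 3(1) gJ unfolding g_def by simp
      have "(\<integral>\<^sup>+x. F x \<partial>lborel) \<le> ennreal (B * K * r) + ennreal (B * K * r)"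
        by (rule order_trans[OF nn_integral_le_reflect add_mono[OF f g]]) measurable
      also have "\<dots> = ennreal (2 * B * K) * J"
        using B K 3 by (simp add: ennreal_mult'[symmetric] ennreal_plus[symmetric] del: ennreal_plus)
      finally show ?thesis using c unfolding F_def J_def by auto
    qed
  qed
  show ?thesis
    using main B K unfolding w_def
    by (intro exI[of _ "2 * B * K"]) (auto simp: mult.assoc)
qed

section \<open>Subadditivity of entropy\<close>

text \<open>Gives integrability on finite measures for functions bounded away from 0 and from
  above.\<close>

lemma rel_ent_bound:
  assumes "0 < e" "e \<le> t" "t \<le> K" "0 < c"
  shows "\<bar>rel_ent c t\<bar> \<le> K\<^sup>2 / c + c"
proof -
  have "rel_ent c t \<le> (t - c)\<^sup>2 / c" using assms by (intro rel_ent_le_square) auto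
  also have "\<dots> \<le> (t\<^sup>2 + c\<^sup>2) / c" using assms by (intro divide_right_mono) (auto simp: power2_diff)
  also have "\<dots> \<le> (K\<^sup>2 + c\<^sup>2) / c" using assms by (intro divide_right_mono add_mono power_mono) auto
  also have "\<dots> = K\<^sup>2 / c + c" using assms by (simp add: field_simps power2_eq_square)
  finally show ?thesis using rel_ent_nonneg[of t c] assms by simp
qed

text \<open>The Pythagorean identity of the divergence: moving the reference value from the mean
  \<open>m\<close> to \<open>c\<close> costs exactly \<open>rel_ent c m\<close> per unit of mass. In
  particular the mean minimises the integral.\<close>

lemma (in finite_measure) rel_ent_mean:
  fixes g :: "'a \<Rightarrow> real"
  assumes [measurable]: "g \<in> borel_measurable M" and e: "0 < e" and bd: "\<And>x. e \<le> g x" "\<And>x. g x \<le> K"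
    and pos: "measure M (space M) > 0" and c: "c > 0"
  defines "m \<equiv> (\<integral>x. g x \<partial>M) / measure M (space M)"
  shows "e \<le> m" "m \<le> K"
    and "(\<integral>\<^sup>+x. ennreal (rel_ent c (g x)) \<partial>M)
      = (\<integral>\<^sup>+x. ennreal (rel_ent m (g x)) \<partial>M) + ennreal (measure M (space M) * rel_ent c m)"
proof -
  define s where "s = measure M (space M)"
  have s: "s > 0" using pos unfolding s_def .
  have intg: "integrable M g"
    using less_le_trans[OF e bd(1)] bd(2) by (intro integrable_const_bound[of _ K]) (auto intro!: AE_I2 simp: abs_of_pos)
  have "(\<integral>x. e \<partial>M) \<le> (\<integral>x. g x \<partial>M)" "(\<integral>x. g x \<partial>M) \<le> (\<integral>x. K \<partial>M)"
    by (intro integral_mono intg bd integrable_const)+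
  then show m1: "e \<le> m" and m2: "m \<le> K" using s unfolding m_def by (simp_all add: field_simps s_def)
  have m: "m > 0" using e m1 by simp
  have gm: "(\<integral>x. g x \<partial>M) = s * m" using s unfolding m_def s_def by simp
  have intr: "integrable M (\<lambda>x. rel_ent d (g x))" if "d > 0" for d
    using rel_ent_bound[OF e _ _ that] bd
    by (intro integrable_const_bound[of _ "K\<^sup>2 / d + d"]) (auto intro!: AE_I2 simp: rel_ent_def)
  have nn: "(\<integral>\<^sup>+x. ennreal (rel_ent d (g x)) \<partial>M) = ennreal (\<integral>x. rel_ent d (g x) \<partial>M)" if "d > 0" for d
    using e bd that by (intro nn_integral_eq_integral intr that AE_I2 rel_ent_nonneg) (auto intro: less_le_trans)
  \<comment> \<open>The difference is affine in \<open>g x\<close>, so its integral depends on the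
    mean only.\<close>
  have "rel_ent c (g x) = rel_ent m (g x) + (g x * ln (m / c) + (c - m))" for x
    using e bd(1)[of x] m c unfolding rel_ent_def by (simp add: ln_div algebra_simps)
  then have "(\<integral>x. rel_ent c (g x) \<partial>M) = (\<integral>x. rel_ent m (g x) + (g x * ln (m / c) + (c - m)) \<partial>M)"
    by simp
  also have "\<dots> = (\<integral>x. rel_ent m (g x) \<partial>M) + (s * m * ln (m / c) + s * (c - m))"
    using intr[OF m] intg gm by (simp add: s_def)
  also have "s * m * ln (m / c) + s * (c - m) = s * rel_ent c m" by (simp add: rel_ent_def algebra_simps)
  finally have eq: "(\<integral>x. rel_ent c (g x) \<partial>M) = (\<integral>x. rel_ent m (g x) \<partial>M) + s * rel_ent c m" .
  have "0 \<le> (\<integral>x. rel_ent m (g x) \<partial>M)"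
    using e bd m by (intro integral_nonneg_AE AE_I2 rel_ent_nonneg) (auto intro: less_le_trans)
  then show "(\<integral>\<^sup>+x. ennreal (rel_ent c (g x)) \<partial>M)
      = (\<integral>\<^sup>+x. ennreal (rel_ent m (g x)) \<partial>M) + ennreal (measure M (space M) * rel_ent c m)"
    using s rel_ent_nonneg[OF m c] by (simp add: nn c m eq s_def ennreal_plus)
qed

text \<open>\<open>ennreal\<close> sends negative values to 0, so the right-hand side integrates the
  positive part.\<close>

lemma ennreal_integral_le_nn_integral:
  fixes f :: "'a \<Rightarrow> real"
  assumes "integrable M f"
  shows "ennreal (\<integral>x. f x \<partial>M) \<le> (\<integral>\<^sup>+x. ennreal (f x) \<partial>M)"
proof -
  have "(\<integral>x. f x \<partial>M) \<le> (\<integral>x. max 0 (f x) \<partial>M)"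
    using assms by (intro integral_mono) auto
  then have "ennreal (\<integral>x. f x \<partial>M) \<le> ennreal (\<integral>x. max 0 (f x) \<partial>M)" by (rule ennreal_leI)
  also have "\<dots> = (\<integral>\<^sup>+x. ennreal (max 0 (f x)) \<partial>M)"
    using assms by (intro nn_integral_eq_integral[symmetric]) auto
  also have "\<dots> = (\<integral>\<^sup>+x. ennreal (f x) \<partial>M)"
    by (intro nn_integral_cong) (auto simp: max_def ennreal_neg)
  finally show ?thesis .
qed

lemma nn_integral_zero_measure:
  assumes "emeasure M (space M) = 0" shows "(\<integral>\<^sup>+x. f x \<partial>M) = 0"
proof -
  have "(\<integral>\<^sup>+x. f x \<partial>M) = (\<integral>\<^sup>+x. 0 \<partial>M)"
    using assms by (intro nn_integral_cong_AE AE_I[of _ _ "space M"]) auto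
  then show ?thesis by simp
qed

text \<open>Young's inequality for the convex conjugate \<open>h -> c * (exp h - 1)\<close> of
  \<open>rel_ent c\<close>. It is nonnegativity of the divergence with reference value
  \<open>c * exp h\<close>.\<close>

lemma mult_le_rel_ent:
  assumes "t > 0" "c > 0" shows "t * h \<le> rel_ent c t + c * (exp h - 1)"
  using rel_ent_nonneg[of t "c * exp h"] assms
  by (simp add: rel_ent_def ln_div ln_mult algebra_simps)

text \<open>
  Subadditivity of entropy: the entropy of the marginal \<open>m y = \<integral> g (x, y)\<close> with mean \<open>c\<close> is
  \<open>\<integral>\<integral> g h\<close> with \<open>h = ln (m / c)\<close>, and on every fibre \<open>x\<close> the Young inequality above bounds
  \<open>\<integral> g (x, \<cdot>) h\<close> by the entropy of \<open>g (x, \<cdot>)\<close> because \<open>exp h\<close> has mean 1.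
\<close>

lemma rel_ent_tensor:
  fixes A :: "'a measure" and B :: "'b measure" and g :: "'a \<times> 'b \<Rightarrow> real"
  assumes fin: "finite_measure A" "finite_measure B"
    and [measurable]: "g \<in> borel_measurable (A \<Otimes>\<^sub>M B)" and e: "0 < e" and bd: "\<And>z. e \<le> g z" "\<And>z. g z \<le> K"
    and [measurable]: "RA \<in> borel_measurable B" "RB \<in> borel_measurable A"
    and lsiA: "\<And>y. y \<in> space B \<Longrightarrow> \<exists>c>0. (\<integral>\<^sup>+x. ennreal (rel_ent c (g (x, y))) \<partial>A) \<le> RA y"
    and lsiB: "\<And>x. x \<in> space A \<Longrightarrow> \<exists>c>0. (\<integral>\<^sup>+y. ennreal (rel_ent c (g (x, y))) \<partial>B) \<le> RB x"
  shows "\<exists>c>0. (\<integral>\<^sup>+z. ennreal (rel_ent c (g z)) \<partial>(A \<Otimes>\<^sub>M B)) \<le> (\<integral>\<^sup>+y. RA y \<partial>B) + (\<integral>\<^sup>+x. RB x \<partial>A)"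
proof -
  interpret A: finite_measure A by fact
  interpret B: finite_measure B by fact
  interpret P: pair_sigma_finite A B ..
  interpret AB: finite_measure "A \<Otimes>\<^sub>M B" by (intro finite_measure_pair_measure fin)
  define a b where "a = measure A (space A)" and "b = measure B (space B)"
  \<comment> \<open>A null factor makes the product null; otherwise averages over \<open>A\<close>
    and \<open>B\<close> can be formed by division.\<close>
  consider "emeasure A (space A) = 0 \<or> emeasure B (space B) = 0" | "a > 0" "b > 0"
    unfolding a_def b_def by (metis A.emeasure_eq_measure B.emeasure_eq_measure ennreal_0 measure_nonneg less_le)
  then show ?thesis
  proof cases
    case 1
    then have "emeasure (A \<Otimes>\<^sub>M B) (space (A \<Otimes>\<^sub>M B)) = 0"
      by (auto simp: space_pair_measure B.emeasure_pair_measure_Times)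
    then show ?thesis by (intro exI[of _ 1]) (simp add: nn_integral_zero_measure)
  next
    case 2
    have gpos: "g z > 0" for z using e bd(1)[of z] by simp
    define m where "m y = (\<integral>x. g (x, y) \<partial>A) / a" for y
    have [measurable]: "m \<in> borel_measurable B" unfolding m_def by measurable
    have sA: "(\<lambda>x. g (x, y)) \<in> borel_measurable A" if "y \<in> space B" for y
      using that by measurable
    have sB: "(\<lambda>y. g (x, y)) \<in> borel_measurable B" if "x \<in> space A" for x
      using that by measurable
    note meanA = A.rel_ent_mean[OF sA e bd 2(1)[unfolded a_def], folded a_def, folded m_def]
    \<comment> \<open>Clamping leaves \<open>m\<close> unchanged on \<open>space B\<close> and makes
      the bounds hold for every \<open>y\<close>, as \<open>rel_ent_mean\<close> asks.\<close>
    define m' where "m' y = max e (min K (m y))" for y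
    have m': "m' y = m y" if "y \<in> space B" for y
      using meanA(1)[OF that zero_less_one] meanA(2)[OF that zero_less_one] unfolding m'_def by simp
    have [measurable]: "m' \<in> borel_measurable B" unfolding m'_def by measurable
    have eK: "e \<le> K" using bd order_trans by blast
    have m'bd: "e \<le> m' y" "m' y \<le> K" for y using eK unfolding m'_def by auto
    define c where "c = (\<integral>y. m' y \<partial>B) / b"
    have cbd: "e \<le> c" "c \<le> K"
      using B.rel_ent_mean(1,2)[of m' e K 1] m'bd e 2(2) unfolding c_def b_def by auto
    have c: "c > 0" using cbd e by simp
    have intm': "integrable B m'"
      using less_le_trans[OF e m'bd(1)] m'bd(2) by (intro B.integrable_const_bound[of _ K]) (auto intro!: AE_I2 simp: abs_of_pos)
    have m'c: "(\<integral>y. m' y \<partial>B) = b * c" using 2 unfolding c_def by simp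
    define h where "h y = ln (m' y / c)" for y
    have m'pos: "m' y > 0" for y using m'bd(1)[of y] e by simp
    have hb: "\<bar>h y\<bar> \<le> ln (K / e)" for y
    proof -
      have "m' y / c \<le> K / e" using m'bd[of y] cbd e eK by (intro frac_le) auto
      moreover have "e / K \<le> m' y / c" using m'bd[of y] cbd e eK c by (intro frac_le) auto
      ultimately have "h y \<le> ln (K / e)" "ln (e / K) \<le> h y"
        using m'pos[of y] c e eK unfolding h_def by (auto intro!: ln_mono)
      then show ?thesis using e eK by (auto simp: ln_div abs_le_iff)
    qed
    have [measurable]: "h \<in> borel_measurable B" unfolding h_def by measurable
    have exph: "exp (h y) = m' y / c" for y using m'pos[of y] c unfolding h_def by simp
    \<comment> \<open>The dependence on \<open>y\<close> of the constant supplied by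
      \<open>lsiA\<close> is unspecified; minimality of the mean allows \<open>m y\<close> to
      replace it.\<close>
    have first: "(\<integral>\<^sup>+x. ennreal (rel_ent (m y) (g (x, y))) \<partial>A) \<le> RA y" if y: "y \<in> space B" for y
    proof -
      obtain c' where c': "c' > 0" "(\<integral>\<^sup>+x. ennreal (rel_ent c' (g (x, y))) \<partial>A) \<le> RA y"
        using lsiA[OF y] by auto
      have "(\<integral>\<^sup>+x. ennreal (rel_ent (m y) (g (x, y))) \<partial>A) \<le> (\<integral>\<^sup>+x. ennreal (rel_ent c' (g (x, y))) \<partial>A)"
        unfolding meanA(3)[OF y c'(1)] by simp
      then show ?thesis using c'(2) by simp
    qed
    have ghbd: "\<bar>g z * h y\<bar> \<le> K * ln (K / e)" for z y
      unfolding abs_mult using hb[of y] bd(2)[of z] gpos[of z] e eK by (intro mult_mono) auto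
    have lnKe: "0 \<le> ln (K / e)" using e eK by simp
    have second: "ennreal (\<integral>y. g (x, y) * h y \<partial>B) \<le> RB x" if x: "x \<in> space A" for x
    proof -
      note [measurable] = sB[OF x]
      obtain c' where c': "c' > 0" "(\<integral>\<^sup>+y. ennreal (rel_ent c' (g (x, y))) \<partial>B) \<le> RB x"
        using lsiB[OF x] by auto
      have ir: "integrable B (\<lambda>y. rel_ent c' (g (x, y)))"
        using rel_ent_bound[OF e _ _ c'(1)] bd
        by (intro B.integrable_const_bound[of _ "K\<^sup>2 / c' + c'"]) (auto intro!: AE_I2 simp: rel_ent_def)
      have "(\<integral>y. g (x, y) * h y \<partial>B) \<le> (\<integral>y. rel_ent c' (g (x, y)) + c' * (m' y / c - 1) \<partial>B)"
      proof (rule integral_mono)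
        show "integrable B (\<lambda>y. g (x, y) * h y)"
          using ghbd by (intro B.integrable_const_bound[of _ "K * ln (K / e)"]) (auto intro!: AE_I2)
        show "integrable B (\<lambda>y. rel_ent c' (g (x, y)) + c' * (m' y / c - 1))"
          using ir intm' by auto
        show "g (x, y) * h y \<le> rel_ent c' (g (x, y)) + c' * (m' y / c - 1)" for y
          using mult_le_rel_ent[OF gpos c'(1), of "(x, y)" "h y"] by (simp add: exph)
      qed
      \<comment> \<open>The correction \<open>c' * (m' y / c - 1)\<close> integrates to 0 for every
        \<open>c'\<close>, because \<open>c\<close> is the mean of \<open>m'\<close>.\<close>
      also have "\<dots> = (\<integral>y. rel_ent c' (g (x, y)) \<partial>B)"
        using ir intm' m'c c by (simp add: b_def)
      finally have "ennreal (\<integral>y. g (x, y) * h y \<partial>B) \<le> ennreal (\<integral>y. rel_ent c' (g (x, y)) \<partial>B)"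
        by (rule ennreal_leI)
      also have "\<dots> = (\<integral>\<^sup>+y. ennreal (rel_ent c' (g (x, y))) \<partial>B)"
        using gpos c' by (intro nn_integral_eq_integral[symmetric] ir AE_I2 rel_ent_nonneg) auto
      also note c'(2)
      finally show ?thesis .
    qed
    have intgh: "integrable (A \<Otimes>\<^sub>M B) (\<lambda>(x, y). g (x, y) * h y)"
      using ghbd by (intro AB.integrable_const_bound[of _ "K * ln (K / e)"]) (auto intro!: AE_I2)
    have ent_m: "(\<integral>\<^sup>+y. ennreal (a * rel_ent c (m y)) \<partial>B) \<le> (\<integral>\<^sup>+x. RB x \<partial>A)"
    proof -
      have ir: "integrable B (\<lambda>y. rel_ent c (m' y))"
        using rel_ent_bound[OF e _ _ c] m'bd
        by (intro B.integrable_const_bound[of _ "K\<^sup>2 / c + c"]) (auto intro!: AE_I2 simp: rel_ent_def)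
      have imh: "integrable B (\<lambda>y. m' y * h y)"
        using hb m'bd m'pos e eK lnKe
        by (intro B.integrable_const_bound[of _ "K * ln (K / e)"]) (auto intro!: AE_I2 mult_mono simp: abs_mult less_imp_le)
      have "(\<integral>\<^sup>+y. ennreal (a * rel_ent c (m y)) \<partial>B) = (\<integral>\<^sup>+y. ennreal (a * rel_ent c (m' y)) \<partial>B)"
        by (intro nn_integral_cong) (simp add: m')
      also have "\<dots> = ennreal (\<integral>y. a * rel_ent c (m' y) \<partial>B)"
        using ir c m'pos 2 by (intro nn_integral_eq_integral AE_I2 mult_nonneg_nonneg rel_ent_nonneg) auto
      also have "(\<integral>y. a * rel_ent c (m' y) \<partial>B) = (\<integral>y. a * (m' y * h y) + a * (c - m' y) \<partial>B)"
        by (intro Bochner_Integration.integral_cong) (auto simp: rel_ent_def h_def algebra_simps)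
      also have "\<dots> = (\<integral>y. a * (m' y * h y) \<partial>B)"
        using imh intm' m'c by (simp add: b_def)
      also have "\<dots> = (\<integral>y. (\<integral>x. g (x, y) * h y \<partial>A) \<partial>B)"
      proof (intro Bochner_Integration.integral_cong refl)
        fix y assume y: "y \<in> space B"
        then show "a * (m' y * h y) = (\<integral>x. g (x, y) * h y \<partial>A)"
          using 2 by (simp add: m' m_def)
      qed
      also have "\<dots> = (\<integral>x. (\<integral>y. g (x, y) * h y \<partial>B) \<partial>A)"
        by (rule P.Fubini_integral[OF intgh])
      \<comment> \<open>The inner integral has no fixed sign; dropping its negative part is harmless
        in this direction.\<close>
      also have "ennreal \<dots> \<le> (\<integral>\<^sup>+x. ennreal (\<integral>y. g (x, y) * h y \<partial>B) \<partial>A)"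
        using P.integrable_fst'[OF intgh] by (intro ennreal_integral_le_nn_integral) simp
      also have "\<dots> \<le> (\<integral>\<^sup>+x. RB x \<partial>A)" by (intro nn_integral_mono second)
      finally show ?thesis .
    qed
    \<comment> \<open>Chain rule: entropies of the fibres over \<open>y\<close> plus the entropy of
      the marginal, by \<open>rel_ent_mean\<close> on each fibre.\<close>
    have "(\<integral>\<^sup>+z. ennreal (rel_ent c (g z)) \<partial>(A \<Otimes>\<^sub>M B)) = (\<integral>\<^sup>+y. (\<integral>\<^sup>+x. ennreal (rel_ent c (g (x, y))) \<partial>A) \<partial>B)"
      by (subst P.nn_integral_snd[symmetric]) (auto simp: rel_ent_def)
    also have "\<dots> = (\<integral>\<^sup>+y. (\<integral>\<^sup>+x. ennreal (rel_ent (m y) (g (x, y))) \<partial>A) + ennreal (a * rel_ent c (m y)) \<partial>B)"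
      by (intro nn_integral_cong meanA(3) c)
    also have "\<dots> = (\<integral>\<^sup>+y. (\<integral>\<^sup>+x. ennreal (rel_ent (m y) (g (x, y))) \<partial>A) \<partial>B) + (\<integral>\<^sup>+y. ennreal (a * rel_ent c (m y)) \<partial>B)"
      unfolding rel_ent_def by (intro nn_integral_add) measurable
    also have "\<dots> \<le> (\<integral>\<^sup>+y. RA y \<partial>B) + (\<integral>\<^sup>+x. RB x \<partial>A)"
      by (intro add_mono ent_m nn_integral_mono first)
    finally show ?thesis using c by auto
  qed
qed

section \<open>Induction on the number of coordinates\<close>

text \<open>Coordinates are functions on a set \<open>I\<close> of basis vectors, so that the
  induction on dimension runs over sets inside one fixed type.\<close>

definition vec_of :: "'a::euclidean_space set \<Rightarrow> ('a \<Rightarrow> real) \<Rightarrow> 'a" where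
  "vec_of I v = (\<Sum>b\<in>I. v b *\<^sub>R b)"

definition sq_sum :: "'a set \<Rightarrow> ('a \<Rightarrow> real) \<Rightarrow> real" where
  "sq_sum I v = (\<Sum>b\<in>I. (v b)\<^sup>2)"

text \<open>Unnormalized, like \<open>cauchy_coords\<close>: finite total mass suffices for
  \<open>rel_ent_tensor\<close>, and a constant factor scales both sides of the inequality
  alike.\<close>

definition cauchy_line :: "real \<Rightarrow> real measure" where
  "cauchy_line \<beta> = density lborel (\<lambda>u. ennreal ((1 + u\<^sup>2) powr (- \<beta>)))"

definition cauchy_coords :: "'a set \<Rightarrow> real \<Rightarrow> ('a \<Rightarrow> real) measure" where
  "cauchy_coords I \<beta> = density (\<Pi>\<^sub>M b\<in>I. lborel) (\<lambda>v. ennreal ((1 + sq_sum I v) powr (- \<beta>)))"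

lemma sq_sum_nonneg [simp]: "0 \<le> sq_sum I v"
  unfolding sq_sum_def by (intro sum_nonneg) auto

lemma one_plus_sq_sum_pos [simp]: "0 < 1 + sq_sum I v"
  by (rule add_pos_nonneg) auto

lemma sq_sum_measurable [measurable]:
  "finite I \<Longrightarrow> sq_sum I \<in> borel_measurable (\<Pi>\<^sub>M b\<in>I. (lborel :: real measure))"
  unfolding sq_sum_def[abs_def] by measurable

lemma vec_of_measurable [measurable]:
  fixes I :: "'a::euclidean_space set"
  shows "finite I \<Longrightarrow> vec_of I \<in> borel_measurable (\<Pi>\<^sub>M b\<in>I. (lborel :: real measure))"
  unfolding vec_of_def[abs_def] by measurable

lemma sets_cauchy_coords [measurable_cong]: "sets (cauchy_coords I \<beta>) = sets (\<Pi>\<^sub>M b\<in>I. (lborel :: real measure))"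
  unfolding cauchy_coords_def by simp

lemma sets_cauchy_line [measurable_cong]: "sets (cauchy_line \<beta>) = sets borel"
  unfolding cauchy_line_def by simp

text \<open>The dominating density \<open>(1 + x) powr (- (2 * \<beta>))\<close> has an explicit
  primitive, which tends to 0 because \<open>2 * \<beta> > 1\<close>; evenness settles the negative
  half-line.\<close>

lemma finite_cauchy_line:
  assumes "\<beta> > 1 / 2" shows "finite_measure (cauchy_line \<beta>)"
proof (rule finite_measureI)
  define a where "a = 2 * \<beta> - 1"
  have a: "a > 0" using assms unfolding a_def by simp
  define F where "F u = ennreal ((1 + u\<^sup>2) powr (- \<beta>))" for u :: real
  have [measurable]: "F \<in> borel_measurable borel" unfolding F_def by measurable
  have "(\<integral>\<^sup>+x. F x * indicator {0..} x \<partial>lborel)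
      \<le> (\<integral>\<^sup>+x. ennreal (2 powr \<beta> * (1 + x) powr (- (2 * \<beta>))) * indicator {0..} x \<partial>lborel)"
    using cauchy_density_le[of _ \<beta>] assms
    by (intro nn_integral_mono) (auto simp: F_def intro!: ennreal_leI split: split_indicator)
  also have "\<dots> = ennreal (0 - 2 powr \<beta> * (- ((1 + 0) powr (- a)) / a))"
  proof (rule nn_integral_FTC_atLeast)
    fix x :: real assume x: "x \<ge> 0"
    have key: "- (2 * \<beta>) = - a - 1" unfolding a_def by simp
    from x have "((\<lambda>x. (1 + x) powr (- a)) has_real_derivative - a * (1 + x) powr (- a - 1) * 1) (at x)"
      by (intro DERIV_chain2[OF has_real_derivative_powr]) (auto intro!: derivative_eq_intros)
    from DERIV_cmult[OF DERIV_cdivide[OF DERIV_minus[OF this], of a], of "2 powr \<beta>"]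
    show "((\<lambda>x. 2 powr \<beta> * (- ((1 + x) powr (- a)) / a)) has_real_derivative
        2 powr \<beta> * (1 + x) powr (- (2 * \<beta>))) (at x)"
      unfolding key using a by simp
  next
    have "((\<lambda>x::real. (1 + x) powr (- a)) \<longlongrightarrow> 0) at_top"
      using a by (intro tendsto_neg_powr filterlim_tendsto_add_at_top[OF tendsto_const filterlim_ident]) auto
    from tendsto_mult[OF tendsto_const tendsto_divide[OF tendsto_minus[OF this] tendsto_const[of a]], of "2 powr \<beta>"]
    show "((\<lambda>x. 2 powr \<beta> * (- ((1 + x) powr (- a)) / a)) \<longlongrightarrow> 0) at_top"
      using a by simp
  qed auto
  finally have half: "(\<integral>\<^sup>+x. F x * indicator {0..} x \<partial>lborel) < \<infinity>"
    by (auto simp: less_top[symmetric] top_unique)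
  have "emeasure (cauchy_line \<beta>) (space (cauchy_line \<beta>)) = (\<integral>\<^sup>+x. F x \<partial>lborel)"
    unfolding cauchy_line_def F_def by (simp add: emeasure_density)
  also have "\<dots> \<le> (\<integral>\<^sup>+x. F x * indicator {0..} x \<partial>lborel) + (\<integral>\<^sup>+x. F (- x) * indicator {0..} x \<partial>lborel)"
    by (rule nn_integral_le_reflect) measurable
  also have "\<dots> < \<infinity>" using half by (simp add: F_def)
  finally show "emeasure (cauchy_line \<beta>) (space (cauchy_line \<beta>)) \<noteq> \<infinity>" by simp
qed

definition insert_coord :: "'a set \<Rightarrow> 'a \<Rightarrow> ('a \<Rightarrow> real) \<times> real \<Rightarrow> 'a \<Rightarrow> real" where
  "insert_coord I j z = (fst z)(j := snd z * sqrt (1 + sq_sum I (fst z)))"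

lemma insert_coord_measurable [measurable]:
  assumes [measurable]: "finite I"
  shows "insert_coord I j \<in> measurable ((\<Pi>\<^sub>M b\<in>I. (lborel :: real measure)) \<Otimes>\<^sub>M borel) (\<Pi>\<^sub>M b\<in>insert j I. (lborel :: real measure))"
proof -
  have "(\<lambda>z. (fst z, snd z * sqrt (1 + sq_sum I (fst z))))
      \<in> measurable ((\<Pi>\<^sub>M b\<in>I. (lborel :: real measure)) \<Otimes>\<^sub>M borel) ((\<Pi>\<^sub>M b\<in>I. (lborel :: real measure)) \<Otimes>\<^sub>M lborel)"
    by measurable
  from measurable_compose[OF this measurable_add_dim[where i = j and I = I and M = "\<lambda>_. lborel"]]
  show ?thesis unfolding insert_coord_def[abs_def] by (simp add: comp_def)
qed

lemma sq_sum_insert_coord: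
  assumes "finite I" "j \<notin> I"
  shows "sq_sum (insert j I) (insert_coord I j (v, u)) = sq_sum I v + u\<^sup>2 * (1 + sq_sum I v)"
proof -
  have "(\<Sum>b\<in>I. ((v(j := t)) b)\<^sup>2) = (\<Sum>b\<in>I. (v b)\<^sup>2)" for t
    using assms by (intro sum.cong) auto
  then have "sq_sum (insert j I) (v(j := t)) = sq_sum I v + t\<^sup>2" for t
    using assms unfolding sq_sum_def by (subst sum.insert) auto
  then show ?thesis
    using one_plus_sq_sum_pos[of I v]
    by (simp add: insert_coord_def power_mult_distrib less_imp_le del: one_plus_sq_sum_pos)
qed

lemma vec_of_insert_coord:
  fixes I :: "'a::euclidean_space set"
  assumes "finite I" "j \<notin> I"
  shows "vec_of (insert j I) (insert_coord I j (v, u)) = vec_of I v + (u * sqrt (1 + sq_sum I v)) *\<^sub>R j"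
proof -
  have "(\<Sum>b\<in>I. ((v(j := t)) b) *\<^sub>R b) = (\<Sum>b\<in>I. v b *\<^sub>R b)" for t
    using assms by (intro sum.cong) auto
  then have "vec_of (insert j I) (v(j := t)) = vec_of I v + t *\<^sub>R j" for t
    using assms unfolding vec_of_def by (subst sum.insert) (auto simp: add.commute)
  then show ?thesis by (simp add: insert_coord_def)
qed

text \<open>Substitution \<open>t = \<sigma> * u\<close> in coordinate \<open>j\<close> with
  \<open>\<sigma> = sqrt (1 + sq_sum I v)\<close>. The density factors, and the Jacobian
  \<open>\<sigma>\<close> shifts the exponent for the remaining coordinates from
  \<open>\<beta>\<close> to \<open>\<beta> - 1/2\<close>.\<close>

lemma nn_integral_cauchy_coords_insert:
  assumes I: "finite I" "j \<notin> I" and \<beta>: "\<beta> > 1 / 2"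
    and [measurable]: "H \<in> borel_measurable (\<Pi>\<^sub>M b\<in>insert j I. (lborel :: real measure))"
  shows "(\<integral>\<^sup>+v. H v \<partial>cauchy_coords (insert j I) \<beta>)
    = (\<integral>\<^sup>+z. H (insert_coord I j z) \<partial>(cauchy_coords I (\<beta> - 1 / 2) \<Otimes>\<^sub>M cauchy_line \<beta>))"
proof -
  interpret product_sigma_finite "\<lambda>_. lborel :: real measure" ..
  interpret B: finite_measure "cauchy_line \<beta>" by (rule finite_cauchy_line[OF \<beta>])
  have [measurable]: "finite I" "finite (insert j I)" using I by auto
  have slice: "(\<integral>\<^sup>+t. ennreal ((1 + sq_sum (insert j I) (v(j := t))) powr (- \<beta>)) * H (v(j := t)) \<partial>lborel)
      = ennreal ((1 + sq_sum I v) powr (- (\<beta> - 1 / 2))) * (\<integral>\<^sup>+u. H (insert_coord I j (v, u)) \<partial>cauchy_line \<beta>)"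
    if v: "v \<in> space (\<Pi>\<^sub>M b\<in>I. (lborel :: real measure))" for v
  proof -
    define \<sigma> where "\<sigma> = sqrt (1 + sq_sum I v)"
    have \<sigma>: "\<sigma> > 0" unfolding \<sigma>_def by simp
    have [measurable]: "(\<lambda>t. v(j := t)) \<in> measurable lborel (\<Pi>\<^sub>M b\<in>insert j I. (lborel :: real measure))"
      using measurable_compose[OF measurable_Pair1'[OF v] measurable_add_dim[where i = j and I = I and M = "\<lambda>_. lborel"]] by simp
    have ins: "insert_coord I j (v, u) = v(j := \<sigma> * u)" for u
      unfolding insert_coord_def \<sigma>_def by (simp add: mult.commute)
    have dens: "\<sigma> * (1 + sq_sum (insert j I) (v(j := \<sigma> * u))) powr (- \<beta>)
        = (1 + sq_sum I v) powr (- (\<beta> - 1 / 2)) * (1 + u\<^sup>2) powr (- \<beta>)" for u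
    proof -
      have "1 + sq_sum (insert j I) (v(j := \<sigma> * u)) = (1 + sq_sum I v) * (1 + u\<^sup>2)"
        using sq_sum_insert_coord[OF I, of v u] unfolding ins by (simp add: algebra_simps)
      moreover have "\<sigma> = (1 + sq_sum I v) powr (1 / 2)" unfolding \<sigma>_def by (simp add: powr_half_sqrt less_imp_le)
      moreover have "(1 + sq_sum I v) powr (1 / 2) * (1 + sq_sum I v) powr (- \<beta>) = (1 + sq_sum I v) powr (- (\<beta> - 1 / 2))"
        by (simp add: powr_add[symmetric])
      ultimately show ?thesis by (simp add: powr_mult add_nonneg_nonneg mult.assoc[symmetric])
    qed
    have "(\<integral>\<^sup>+t. ennreal ((1 + sq_sum (insert j I) (v(j := t))) powr (- \<beta>)) * H (v(j := t)) \<partial>lborel)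
      = ennreal \<sigma> * (\<integral>\<^sup>+u. ennreal ((1 + sq_sum (insert j I) (v(j := \<sigma> * u))) powr (- \<beta>)) * H (v(j := \<sigma> * u)) \<partial>lborel)"
      using \<sigma> by (subst nn_integral_real_affine[where c = \<sigma> and t = 0]) auto
    also have "\<dots> = (\<integral>\<^sup>+u. ennreal \<sigma> * (ennreal ((1 + sq_sum (insert j I) (v(j := \<sigma> * u))) powr (- \<beta>)) * H (v(j := \<sigma> * u))) \<partial>lborel)"
      by (intro nn_integral_cmult[symmetric]) measurable
    also have "\<dots> = (\<integral>\<^sup>+u. ennreal ((1 + sq_sum I v) powr (- (\<beta> - 1 / 2))) * (ennreal ((1 + u\<^sup>2) powr (- \<beta>)) * H (v(j := \<sigma> * u))) \<partial>lborel)"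
      using \<sigma> dens by (intro nn_integral_cong) (simp add: mult.assoc[symmetric] ennreal_mult'[symmetric])
    also have "\<dots> = ennreal ((1 + sq_sum I v) powr (- (\<beta> - 1 / 2))) * (\<integral>\<^sup>+u. ennreal ((1 + u\<^sup>2) powr (- \<beta>)) * H (v(j := \<sigma> * u)) \<partial>lborel)"
      by (intro nn_integral_cmult) measurable
    also have "(\<integral>\<^sup>+u. ennreal ((1 + u\<^sup>2) powr (- \<beta>)) * H (v(j := \<sigma> * u)) \<partial>lborel)
        = (\<integral>\<^sup>+u. H (insert_coord I j (v, u)) \<partial>cauchy_line \<beta>)"
      unfolding cauchy_line_def ins by (subst nn_integral_density) auto
    finally show ?thesis .
  qed
  have "(\<integral>\<^sup>+v. H v \<partial>cauchy_coords (insert j I) \<beta>)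
    = (\<integral>\<^sup>+v. ennreal ((1 + sq_sum (insert j I) v) powr (- \<beta>)) * H v \<partial>(\<Pi>\<^sub>M b\<in>insert j I. lborel))"
    unfolding cauchy_coords_def by (intro nn_integral_density) measurable
  also have "\<dots> = (\<integral>\<^sup>+v. (\<integral>\<^sup>+t. ennreal ((1 + sq_sum (insert j I) (v(j := t))) powr (- \<beta>)) * H (v(j := t)) \<partial>lborel) \<partial>(\<Pi>\<^sub>M b\<in>I. lborel))"
    using I by (intro product_nn_integral_insert) measurable
  also have "\<dots> = (\<integral>\<^sup>+v. ennreal ((1 + sq_sum I v) powr (- (\<beta> - 1 / 2))) * (\<integral>\<^sup>+u. H (insert_coord I j (v, u)) \<partial>cauchy_line \<beta>) \<partial>(\<Pi>\<^sub>M b\<in>I. lborel))"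
    by (intro nn_integral_cong slice)
  also have "\<dots> = (\<integral>\<^sup>+v. (\<integral>\<^sup>+u. H (insert_coord I j (v, u)) \<partial>cauchy_line \<beta>) \<partial>cauchy_coords I (\<beta> - 1 / 2))"
    unfolding cauchy_coords_def by (intro nn_integral_density[symmetric]) measurable
  also have "\<dots> = (\<integral>\<^sup>+z. H (insert_coord I j z) \<partial>(cauchy_coords I (\<beta> - 1 / 2) \<Otimes>\<^sub>M cauchy_line \<beta>))"
    by (intro B.nn_integral_fst) measurable
  finally show ?thesis .
qed

text \<open>Removing a coordinate lowers \<open>\<beta>\<close> and the threshold
  \<open>card I / 2\<close> by 1/2 each, so the hypothesis persists. With no coordinates left the
  space is a single point of mass 1.\<close>

lemma finite_cauchy_coords:
  fixes I :: "'a set"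
  assumes "finite I" "\<beta> > real (card I) / 2"
  shows "finite_measure (cauchy_coords I \<beta>)"
  using assms
proof (induction I arbitrary: \<beta> rule: finite_induct)
  case empty
  interpret product_sigma_finite "\<lambda>_. lborel :: real measure" ..
  have "emeasure (cauchy_coords ({} :: 'a set) \<beta>) (space (cauchy_coords ({} :: 'a set) \<beta>)) = 1"
    unfolding cauchy_coords_def
    by (simp add: density_1 emeasure_PiM_empty space_PiM_empty sq_sum_def)
  then show ?case by (intro finite_measureI) simp
next
  case (insert j I)
  have \<beta>: "\<beta> > 1 / 2" using insert by (simp add: field_simps)
  interpret A: finite_measure "cauchy_coords I (\<beta> - 1 / 2)"
    using insert by (intro insert.IH) (simp add: field_simps)
  interpret AB: finite_measure "cauchy_coords I (\<beta> - 1 / 2) \<Otimes>\<^sub>M cauchy_line \<beta>"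
    by (intro finite_measure_pair_measure finite_cauchy_line \<beta>) unfold_locales
  have "emeasure (cauchy_coords (insert j I) \<beta>) (space (cauchy_coords (insert j I) \<beta>))
      = (\<integral>\<^sup>+v. 1 \<partial>cauchy_coords (insert j I) \<beta>)" by simp
  also have "\<dots> = (\<integral>\<^sup>+z. 1 \<partial>(cauchy_coords I (\<beta> - 1 / 2) \<Otimes>\<^sub>M cauchy_line \<beta>))"
    using insert by (intro nn_integral_cauchy_coords_insert \<beta>) auto
  also have "\<dots> < \<infinity>" by (simp add: AB.emeasure_finite less_top[symmetric])
  finally show ?case by (intro finite_measureI) simp
qed

section \<open>Behaviour of the weighted gradient under the coordinate change\<close>

text \<open>Here \<open>p b\<close> and \<open>q\<close> stand for the partial derivatives of
  \<open>f\<close> along \<open>b\<close> and along the new direction \<open>j\<close>. The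
  left-hand sides are the weighted squared derivatives of \<open>f\<close> after the coordinate
  change, first in \<open>v\<close> with \<open>u\<close> fixed, then in \<open>u\<close> with
  \<open>v\<close> fixed. Both are controlled since \<open>1 + |x|^2 = (1 + S) (1 + u^2)\<close>
  with \<open>S = sq_sum I v\<close>.\<close>

lemma coords_gradient_bound:
  fixes p v :: "'a \<Rightarrow> real"
  assumes "finite I"
  shows "(\<Sum>b\<in>I. (p b + q * u * v b / sqrt (1 + sq_sum I v))\<^sup>2) * ((1 + sq_sum I v) * ln (exp 1 + sq_sum I v))
    \<le> 2 * (((\<Sum>b\<in>I. (p b)\<^sup>2) + q\<^sup>2)
      * ((1 + (sq_sum I v + u\<^sup>2 * (1 + sq_sum I v))) * ln (exp 1 + (sq_sum I v + u\<^sup>2 * (1 + sq_sum I v)))))"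
    (is "?l * ?w \<le> 2 * (?r * ?w')")
    and "(q * sqrt (1 + sq_sum I v))\<^sup>2 * ((1 + u\<^sup>2) * ln (exp 1 + u\<^sup>2))
    \<le> ((\<Sum>b\<in>I. (p b)\<^sup>2) + q\<^sup>2)
      * ((1 + (sq_sum I v + u\<^sup>2 * (1 + sq_sum I v))) * ln (exp 1 + (sq_sum I v + u\<^sup>2 * (1 + sq_sum I v))))"
    (is "?m \<le> ?r * ?w'")
proof -
  define S where "S = sq_sum I v"
  have S: "S \<ge> 0" unfolding S_def by simp
  define P where "P = (\<Sum>b\<in>I. (p b)\<^sup>2)"
  have P: "P \<ge> 0" unfolding P_def by (intro sum_nonneg) auto
  have e: "ln (exp 1 + x) \<ge> 0" if "x \<ge> 0" for x :: real
    using that by (intro ln_ge_zero) (simp add: add_increasing2)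
  have l: "ln (exp 1 + S) \<le> ln (exp 1 + (S + u\<^sup>2 * (1 + S)))" "ln (exp 1 + u\<^sup>2) \<le> ln (exp 1 + (S + u\<^sup>2 * (1 + S)))"
  proof -
    have "0 \<le> u\<^sup>2 * (1 + S)" "u\<^sup>2 \<le> S + u\<^sup>2 * (1 + S)" using S by (simp_all add: algebra_simps)
    then show "ln (exp 1 + S) \<le> ln (exp 1 + (S + u\<^sup>2 * (1 + S)))" "ln (exp 1 + u\<^sup>2) \<le> ln (exp 1 + (S + u\<^sup>2 * (1 + S)))"
      using S by (intro ln_mono add_left_mono; simp add: add_pos_nonneg)+
  qed
  have "?l \<le> (\<Sum>b\<in>I. 2 * (p b)\<^sup>2 + 2 * (q * u)\<^sup>2 / (1 + S) * (v b)\<^sup>2)"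
  proof (intro sum_mono)
    fix b
    have "(x + y)\<^sup>2 \<le> 2 * x\<^sup>2 + 2 * y\<^sup>2" for x y :: real
      using zero_le_power2[of "x - y"] by (simp add: power2_eq_square algebra_simps)
    from this[of "p b" "q * u * v b / sqrt (1 + S)"]
    show "(p b + q * u * v b / sqrt (1 + sq_sum I v))\<^sup>2 \<le> 2 * (p b)\<^sup>2 + 2 * (q * u)\<^sup>2 / (1 + S) * (v b)\<^sup>2"
      using S by (simp add: power_divide power_mult_distrib S_def)
  qed
  also have "\<dots> = 2 * P + 2 * (q * u)\<^sup>2 / (1 + S) * S"
    unfolding P_def S_def sq_sum_def by (simp add: sum.distrib sum_distrib_left)
  \<comment> \<open>\<open>S / (1 + S) <= 1\<close>: the extra term from the chain rule costs only
    \<open>u^2\<close>, which the factor \<open>1 + u^2\<close> of the full weight pays for.\<close>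
  also have "\<dots> \<le> 2 * P + 2 * (q * u)\<^sup>2"
    using S by (simp add: divide_simps) (simp add: algebra_simps)
  also have "\<dots> \<le> 2 * (P + q\<^sup>2) * (1 + u\<^sup>2)"
    using P by (simp add: algebra_simps power_mult_distrib)
  finally have "?l \<le> 2 * (P + q\<^sup>2) * (1 + u\<^sup>2)" .
  then have "?l * ?w \<le> 2 * (P + q\<^sup>2) * (1 + u\<^sup>2) * ((1 + S) * ln (exp 1 + (S + u\<^sup>2 * (1 + S))))"
    unfolding S_def[symmetric] using S P l e[OF S] by (intro mult_mono) auto
  also have "\<dots> = 2 * (?r * ?w')"
    unfolding S_def[symmetric] P_def[symmetric] by (simp add: algebra_simps)
  finally show "?l * ?w \<le> 2 * (?r * ?w')" .
  have "?m = q\<^sup>2 * ((1 + S) * ((1 + u\<^sup>2) * ln (exp 1 + u\<^sup>2)))"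
    using S by (simp add: power_mult_distrib S_def)
  also have "\<dots> \<le> (P + q\<^sup>2) * ((1 + S) * ((1 + u\<^sup>2) * ln (exp 1 + (S + u\<^sup>2 * (1 + S)))))"
    using S P l e[of "u\<^sup>2"] by (intro mult_mono mult_left_mono) auto
  also have "\<dots> = ?r * ?w'"
    unfolding S_def[symmetric] P_def[symmetric] by (simp add: algebra_simps)
  finally show "?m \<le> ?r * ?w'" .
qed

lemma inner_vec_of:
  assumes "finite I" "I \<subseteq> Basis" "b \<in> I"
  shows "vec_of I v \<bullet> b = v b"
proof -
  have "vec_of I v \<bullet> b = (\<Sum>i\<in>I. v i * (if i = b then 1 else 0))"
    unfolding vec_of_def inner_sum_left using assms
    by (intro sum.cong refl) (simp add: inner_Basis subsetD[OF assms(2)])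
  also have "\<dots> = (\<Sum>i\<in>I. if i = b then v i else 0)" by (intro sum.cong) auto
  finally show ?thesis using assms by simp
qed

text \<open>Chain rule for the slice with \<open>u\<close> fixed. Reading coordinates as inner
  products extends the slice to the whole space, where the induction hypothesis expects its
  functions to live.\<close>

lemma vec_of_insert_has_derivative:
  fixes f :: "'a::euclidean_space \<Rightarrow> real" and u :: real and j :: 'a
  assumes I: "finite I" and f: "\<And>x. (f has_derivative (\<lambda>h. g x \<bullet> h)) (at x)"
  defines "Y \<equiv> \<lambda>x. vec_of I (\<lambda>b. x \<bullet> b) + (u * sqrt (1 + sq_sum I (\<lambda>b. x \<bullet> b))) *\<^sub>R j"
  shows "((\<lambda>x. f (Y x)) has_derivative
    (\<lambda>h. vec_of I (\<lambda>b. g (Y x) \<bullet> b + g (Y x) \<bullet> j * u * (x \<bullet> b) / sqrt (1 + sq_sum I (\<lambda>b. x \<bullet> b))) \<bullet> h)) (at x)"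
proof -
  define s where "s = sqrt (1 + sq_sum I (\<lambda>b. x \<bullet> b))"
  have s: "s > 0" unfolding s_def by simp
  have 1: "((\<lambda>x. 1 + sq_sum I (\<lambda>b. x \<bullet> b)) has_derivative (\<lambda>h. \<Sum>b\<in>I. 2 * (x \<bullet> b) * (h \<bullet> b))) (at x)"
    unfolding sq_sum_def by (auto intro!: derivative_eq_intros sum.cong simp: mult_ac)
  have 2: "((\<lambda>x. vec_of I (\<lambda>b. x \<bullet> b)) has_derivative (\<lambda>h. \<Sum>b\<in>I. (h \<bullet> b) *\<^sub>R b)) (at x)"
    unfolding vec_of_def by (auto intro!: derivative_eq_intros)
  have "(Y has_derivative (\<lambda>h. (\<Sum>b\<in>I. (h \<bullet> b) *\<^sub>R b)
      + (u * ((\<Sum>b\<in>I. 2 * (x \<bullet> b) * (h \<bullet> b)) * (inverse s / 2))) *\<^sub>R j)) (at x)"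
    unfolding Y_def s_def
    by (intro has_derivative_add 2 has_derivative_scaleR_left has_derivative_mult_right
        has_derivative_real_sqrt[OF one_plus_sq_sum_pos 1])
  from has_derivative_compose[OF this f]
  have "((\<lambda>x. f (Y x)) has_derivative (\<lambda>h. g (Y x) \<bullet> ((\<Sum>b\<in>I. (h \<bullet> b) *\<^sub>R b)
      + (u * ((\<Sum>b\<in>I. 2 * (x \<bullet> b) * (h \<bullet> b)) * (inverse s / 2))) *\<^sub>R j))) (at x)" .
  moreover have "g (Y x) \<bullet> ((\<Sum>b\<in>I. (h \<bullet> b) *\<^sub>R b) + (u * ((\<Sum>b\<in>I. 2 * (x \<bullet> b) * (h \<bullet> b)) * (inverse s / 2))) *\<^sub>R j)
    = vec_of I (\<lambda>b. g (Y x) \<bullet> b + g (Y x) \<bullet> j * u * (x \<bullet> b) / s) \<bullet> h" for h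
  proof -
    have "g (Y x) \<bullet> ((\<Sum>b\<in>I. (h \<bullet> b) *\<^sub>R b) + (u * ((\<Sum>b\<in>I. 2 * (x \<bullet> b) * (h \<bullet> b)) * (inverse s / 2))) *\<^sub>R j)
      = (\<Sum>b\<in>I. (h \<bullet> b) * (g (Y x) \<bullet> b)) + (\<Sum>b\<in>I. (x \<bullet> b) * (h \<bullet> b) * (u * inverse s * (g (Y x) \<bullet> j)))"
      by (simp add: inner_add_right inner_sum_right sum_distrib_left sum_distrib_right mult_ac)
    also have "\<dots> = (\<Sum>b\<in>I. (g (Y x) \<bullet> b + g (Y x) \<bullet> j * u * (x \<bullet> b) / s) * (h \<bullet> b))"
      unfolding sum.distrib[symmetric] by (intro sum.cong) (auto simp: algebra_simps divide_inverse)
    also have "\<dots> = vec_of I (\<lambda>b. g (Y x) \<bullet> b + g (Y x) \<bullet> j * u * (x \<bullet> b) / s) \<bullet> h"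
      unfolding vec_of_def inner_sum_left by (simp add: inner_commute)
    finally show ?thesis .
  qed
  ultimately show ?thesis unfolding s_def[symmetric] by simp
qed

lemma continuous_on_vec_of [continuous_intros]:
  "(\<And>b. b \<in> I \<Longrightarrow> continuous_on S (\<lambda>x. v x b)) \<Longrightarrow> continuous_on S (\<lambda>x. vec_of I (v x))"
  unfolding vec_of_def by (intro continuous_intros)

lemma continuous_on_sq_sum [continuous_intros]:
  fixes v :: "'b::topological_space \<Rightarrow> 'a \<Rightarrow> real"
  shows "(\<And>b. b \<in> I \<Longrightarrow> continuous_on S (\<lambda>x. v x b)) \<Longrightarrow> continuous_on S (\<lambda>x. sq_sum I (v x))"
  unfolding sq_sum_def by (intro continuous_intros)

text \<open>Adding a coordinate combines the induction hypothesis at \<open>\<beta> - 1/2\<close>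
  with the one-dimensional inequality at \<open>\<beta>\<close> through
  \<open>rel_ent_tensor\<close>. The bounds \<open>e\<close> and \<open>K\<close> provide
  integrability there; \<open>C\<close> is chosen before them, which later allows a limit in
  \<open>e\<close>.\<close>

lemma cauchy_coords_lsi:
  fixes I :: "'a::euclidean_space set"
  assumes "finite I" "I \<subseteq> Basis" "\<beta> > real (card I) / 2"
  shows "\<exists>C>0. \<forall>f g e K. (\<forall>x. (f has_derivative (\<lambda>h. g x \<bullet> h)) (at x)) \<longrightarrow> continuous_on UNIV g \<longrightarrow>
      e > 0 \<longrightarrow> (\<forall>x. e \<le> f x) \<longrightarrow> (\<forall>x. f x \<le> K) \<longrightarrow>
    (\<exists>c>0. (\<integral>\<^sup>+v. ennreal (rel_ent c ((f (vec_of I v))\<^sup>2)) \<partial>cauchy_coords I \<beta>)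
      \<le> ennreal C * (\<integral>\<^sup>+v. ennreal ((\<Sum>b\<in>I. (g (vec_of I v) \<bullet> b)\<^sup>2)
          * ((1 + sq_sum I v) * ln (exp 1 + sq_sum I v))) \<partial>cauchy_coords I \<beta>))"
  using assms
proof (induction I arbitrary: \<beta> rule: finite_induct)
  case empty
  have const: "\<exists>c>0. (\<integral>\<^sup>+v. ennreal (rel_ent c ((f (vec_of {} v))\<^sup>2)) \<partial>cauchy_coords {} \<beta>) \<le> X"
    if "e > 0" "\<forall>x. e \<le> f x" for f :: "'a \<Rightarrow> real" and e X
  proof -
    \<comment> \<open>The empty sum \<open>vec_of {} v\<close> is 0, so the reference value
      \<open>(f 0)^2\<close> makes the integrand vanish.\<close>
    have "f 0 > 0" using that by (metis less_le_trans)
    then show ?thesis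
      by (intro exI[of _ "(f 0)\<^sup>2"]) (simp add: vec_of_def rel_ent_def)
  qed
  show ?case by (intro exI[of _ 1] conjI allI impI const) auto
next
  case (insert j I)
  have \<beta>: "\<beta> > 1 / 2" and \<beta>I: "\<beta> - 1 / 2 > real (card I) / 2"
    using insert by (simp_all add: field_simps)
  have IB: "I \<subseteq> Basis" "j \<in> Basis" using insert by auto
  note I = insert(1,2)
  have [measurable]: "finite I" "finite (insert j I)" using I by auto
  define A where "A = cauchy_coords I (\<beta> - 1 / 2)"
  define B where "B = cauchy_line \<beta>"
  have [measurable_cong]: "sets A = sets (\<Pi>\<^sub>M b\<in>I. (lborel :: real measure))" "sets B = sets borel"
    unfolding A_def B_def by (simp_all add: sets_cauchy_coords sets_cauchy_line)
  have finA: "finite_measure A" and finB: "finite_measure B"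
    unfolding A_def B_def using finite_cauchy_coords[OF I(1) \<beta>I] finite_cauchy_line[OF \<beta>] by auto
  interpret A: finite_measure A by (rule finA)
  interpret B: finite_measure B by (rule finB)
  interpret P: pair_sigma_finite A B ..
  obtain C1 where C1: "C1 > 0" and lsi1: "\<forall>f g e K. (\<forall>x. (f has_derivative (\<lambda>h. g x \<bullet> h)) (at x)) \<longrightarrow> continuous_on UNIV g \<longrightarrow>
      e > 0 \<longrightarrow> (\<forall>x. e \<le> f x) \<longrightarrow> (\<forall>x. f x \<le> K) \<longrightarrow>
    (\<exists>c>0. (\<integral>\<^sup>+v. ennreal (rel_ent c ((f (vec_of I v))\<^sup>2)) \<partial>A)
      \<le> ennreal C1 * (\<integral>\<^sup>+v. ennreal ((\<Sum>b\<in>I. (g (vec_of I v) \<bullet> b)\<^sup>2)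
          * ((1 + sq_sum I v) * ln (exp 1 + sq_sum I v))) \<partial>A))"
    using insert.IH[OF IB(1) \<beta>I, folded A_def] by (elim exE conjE) (rule that)
  obtain C2 where C2: "C2 > 0" and lsi2: "\<forall>f f'. (\<forall>x. f x > 0) \<longrightarrow> (\<forall>x. (f has_real_derivative f' x) (at x)) \<longrightarrow> continuous_on UNIV f' \<longrightarrow>
    (\<exists>c>0. (\<integral>\<^sup>+x. ennreal (rel_ent c ((f x)\<^sup>2) * (1 + x\<^sup>2) powr (- \<beta>)) \<partial>lborel)
      \<le> ennreal C2 * (\<integral>\<^sup>+x. ennreal ((f' x)\<^sup>2 * ((1 + x\<^sup>2) * ln (exp 1 + x\<^sup>2)) * (1 + x\<^sup>2) powr (- \<beta>)) \<partial>lborel))"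
    using one_dim_cauchy_lsi[OF \<beta>] by (elim exE conjE) (rule that)
  have step: "\<exists>c>0. (\<integral>\<^sup>+v. ennreal (rel_ent c ((f (vec_of (insert j I) v))\<^sup>2)) \<partial>cauchy_coords (insert j I) \<beta>)
      \<le> ennreal (2 * C1 + C2) * (\<integral>\<^sup>+v. ennreal ((\<Sum>b\<in>insert j I. (g (vec_of (insert j I) v) \<bullet> b)\<^sup>2)
          * ((1 + sq_sum (insert j I) v) * ln (exp 1 + sq_sum (insert j I) v))) \<partial>cauchy_coords (insert j I) \<beta>)"
    if f: "\<And>x. (f has_derivative (\<lambda>h. g x \<bullet> h)) (at x)" and g: "continuous_on UNIV g"
      and e: "e > 0" and bd: "\<And>x. e \<le> f x" "\<And>x. f x \<le> K" for f g e K
  proof -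
    have fpos: "f x > 0" for x using e bd(1)[of x] by simp
    have contf: "continuous_on UNIV f"
      using f by (meson continuous_at_imp_continuous_on has_derivative_continuous)
    have [measurable]: "f \<in> borel_measurable borel" "g \<in> borel_measurable borel"
      using contf g by (auto intro: borel_measurable_continuous_onI)
    define \<sigma> where "\<sigma> v = sqrt (1 + sq_sum I v)" for v
    define Y where "Y z = vec_of (insert j I) (insert_coord I j z)" for z
    have Y: "Y (v, u) = vec_of I v + (u * \<sigma> v) *\<^sub>R j" for v u
      unfolding Y_def \<sigma>_def by (rule vec_of_insert_coord[OF I])
    have YI: "insert_coord I j \<in> measurable (A \<Otimes>\<^sub>M B) (\<Pi>\<^sub>M b\<in>insert j I. (lborel :: real measure))"
      using insert_coord_measurable[OF I(1), of j] by (simp cong: measurable_cong_sets)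
    have [measurable]: "Y \<in> borel_measurable (A \<Otimes>\<^sub>M B)"
      unfolding Y_def using measurable_compose[OF YI vec_of_measurable] I by simp
    define R where "R v = (\<Sum>b\<in>insert j I. (g (vec_of (insert j I) v) \<bullet> b)\<^sup>2)
          * ((1 + sq_sum (insert j I) v) * ln (exp 1 + sq_sum (insert j I) v))" for v
    have Rm [measurable]: "R \<in> borel_measurable (\<Pi>\<^sub>M b\<in>insert j I. (lborel :: real measure))"
      unfolding R_def by measurable
    have [measurable]: "(\<lambda>z. R (insert_coord I j z)) \<in> borel_measurable (A \<Otimes>\<^sub>M B)"
      using measurable_compose[OF YI Rm] by simp
    have Rz: "R (insert_coord I j (v, u)) = ((\<Sum>b\<in>I. (g (Y (v, u)) \<bullet> b)\<^sup>2) + (g (Y (v, u)) \<bullet> j)\<^sup>2)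
      * ((1 + (sq_sum I v + u\<^sup>2 * (1 + sq_sum I v))) * ln (exp 1 + (sq_sum I v + u\<^sup>2 * (1 + sq_sum I v))))" for v u
      unfolding R_def Y_def[symmetric] sq_sum_insert_coord[OF I] using I by (simp add: add.commute)
    \<comment> \<open>The factor 2 is the one lost in
      \<open>coords_gradient_bound(1)\<close>.\<close>
    define RA where "RA u = ennreal (2 * C1) * (\<integral>\<^sup>+v. ennreal (R (insert_coord I j (v, u))) \<partial>A)" for u
    define RB where "RB v = ennreal C2 * (\<integral>\<^sup>+u. ennreal (R (insert_coord I j (v, u))) \<partial>B)" for v
    have [measurable]: "RA \<in> borel_measurable B" "RB \<in> borel_measurable A"
      unfolding RA_def RB_def by measurable
    have lsiA: "\<exists>c>0. (\<integral>\<^sup>+v. ennreal (rel_ent c ((f (Y (v, u)))\<^sup>2)) \<partial>A) \<le> RA u" for u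
    proof -
      define y where "y x = vec_of I (\<lambda>b. x \<bullet> b) + (u * sqrt (1 + sq_sum I (\<lambda>b. x \<bullet> b))) *\<^sub>R j" for x
      define g' where "g' x = vec_of I (\<lambda>b. g (y x) \<bullet> b + g (y x) \<bullet> j * u * (x \<bullet> b) / sqrt (1 + sq_sum I (\<lambda>b. x \<bullet> b)))" for x
      have d: "((\<lambda>x. f (y x)) has_derivative (\<lambda>h. g' x \<bullet> h)) (at x)" for x
        unfolding g'_def y_def by (rule vec_of_insert_has_derivative[OF I(1) f])
      have conty: "continuous_on UNIV y" unfolding y_def by (intro continuous_intros)
      have contg': "continuous_on UNIV g'"
        unfolding g'_def
        by (intro continuous_intros continuous_on_compose2[OF g conty]) (auto simp: less_imp_neq[THEN not_sym])
      obtain c where c: "c > 0" "(\<integral>\<^sup>+v. ennreal (rel_ent c ((f (y (vec_of I v)))\<^sup>2)) \<partial>A)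
        \<le> ennreal C1 * (\<integral>\<^sup>+v. ennreal ((\<Sum>b\<in>I. (g' (vec_of I v) \<bullet> b)\<^sup>2)
          * ((1 + sq_sum I v) * ln (exp 1 + sq_sum I v))) \<partial>A)"
        using lsi1[rule_format, of "\<lambda>x. f (y x)" g' e K, OF d contg' e bd] by auto
      \<comment> \<open>On the span of \<open>I\<close> the inner products return the coordinates,
        so the extended slice \<open>y\<close> agrees with \<open>Y (v, u)\<close> there.\<close>
      have coords: "vec_of I (\<lambda>b. vec_of I v \<bullet> b) = vec_of I v" "sq_sum I (\<lambda>b. vec_of I v \<bullet> b) = sq_sum I v" for v
      proof -
        show "vec_of I (\<lambda>b. vec_of I v \<bullet> b) = vec_of I v"
        proof -
          have "vec_of I (\<lambda>b. vec_of I v \<bullet> b) = (\<Sum>b\<in>I. (vec_of I v \<bullet> b) *\<^sub>R b)" by (rule vec_of_def)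
          also have "\<dots> = (\<Sum>b\<in>I. v b *\<^sub>R b)"
            using inner_vec_of[OF I(1) IB(1)] by (intro sum.cong) auto
          finally show ?thesis unfolding vec_of_def[of I v] .
        qed
        show "sq_sum I (\<lambda>b. vec_of I v \<bullet> b) = sq_sum I v"
          unfolding sq_sum_def using inner_vec_of[OF I(1) IB(1)] by (intro sum.cong) auto
      qed
      have yv: "y (vec_of I v) = Y (v, u)" for v unfolding y_def Y coords \<sigma>_def ..
      have g'v: "(\<Sum>b\<in>I. (g' (vec_of I v) \<bullet> b)\<^sup>2)
        = (\<Sum>b\<in>I. (g (Y (v, u)) \<bullet> b + g (Y (v, u)) \<bullet> j * u * v b / sqrt (1 + sq_sum I v))\<^sup>2)" for v
        unfolding g'_def yv coords using inner_vec_of[OF I(1) IB(1)] by (intro sum.cong) auto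
      note c(2)
      also have "ennreal C1 * (\<integral>\<^sup>+v. ennreal ((\<Sum>b\<in>I. (g' (vec_of I v) \<bullet> b)\<^sup>2)
          * ((1 + sq_sum I v) * ln (exp 1 + sq_sum I v))) \<partial>A)
        \<le> ennreal C1 * (\<integral>\<^sup>+v. ennreal 2 * ennreal (R (insert_coord I j (v, u))) \<partial>A)"
        unfolding g'v Rz ennreal_mult'[symmetric, of 2, OF zero_le_numeral]
        by (intro mult_left_mono nn_integral_mono ennreal_leI coords_gradient_bound(1) I(1)) simp
      also have "\<dots> = RA u"
      proof -
        have "(\<lambda>v. ennreal (R (insert_coord I j (v, u)))) \<in> borel_measurable A"
          by (rule measurable_compose[OF measurable_Pair2'[of u B A]]) (auto simp: B_def cauchy_line_def)
        then show ?thesis unfolding RA_def using C1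
          by (simp add: nn_integral_cmult ennreal_mult' mult_ac del: ennreal_numeral)
      qed
      finally show ?thesis using c(1) unfolding yv by auto
    qed
    \<comment> \<open>The one-dimensional inequality along the line through
      \<open>vec_of I v\<close> in direction \<open>j\<close>, parametrised by \<open>u\<close> with
      speed \<open>\<sigma> v\<close>.\<close>
    have lsiB: "\<exists>c>0. (\<integral>\<^sup>+u. ennreal (rel_ent c ((f (Y (v, u)))\<^sup>2)) \<partial>B) \<le> RB v"
      if v: "v \<in> space A" for v
    proof -
      have cY: "continuous_on UNIV (\<lambda>u. Y (v, u))" unfolding Y by (intro continuous_intros)
      have [measurable]: "(\<lambda>u. Y (v, u)) \<in> borel_measurable borel"
        using cY by (rule borel_measurable_continuous_onI)
      have d: "((\<lambda>u. f (Y (v, u))) has_real_derivative (g (Y (v, u)) \<bullet> j) * \<sigma> v) (at u)" for u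
      proof -
        have "((\<lambda>u. Y (v, u)) has_derivative (\<lambda>h. (h * \<sigma> v) *\<^sub>R j)) (at u)"
          unfolding Y by (auto intro!: derivative_eq_intros)
        from has_derivative_compose[OF this f] show ?thesis
          unfolding has_field_derivative_def
          by (rule has_derivative_eq_rhs) (simp add: fun_eq_iff mult_ac)
      qed
      have cd: "continuous_on UNIV (\<lambda>u. (g (Y (v, u)) \<bullet> j) * \<sigma> v)"
        by (intro continuous_intros continuous_on_compose2[OF g cY]) auto
      obtain c where c: "c > 0" "(\<integral>\<^sup>+u. ennreal (rel_ent c ((f (Y (v, u)))\<^sup>2) * (1 + u\<^sup>2) powr (- \<beta>)) \<partial>lborel)
        \<le> ennreal C2 * (\<integral>\<^sup>+u. ennreal ((g (Y (v, u)) \<bullet> j * \<sigma> v)\<^sup>2 * ((1 + u\<^sup>2) * ln (exp 1 + u\<^sup>2)) * (1 + u\<^sup>2) powr (- \<beta>)) \<partial>lborel)"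
        using lsi2[rule_format, OF fpos d cd] by auto
      have "(\<integral>\<^sup>+u. ennreal (rel_ent c ((f (Y (v, u)))\<^sup>2)) \<partial>B)
        = (\<integral>\<^sup>+u. ennreal (rel_ent c ((f (Y (v, u)))\<^sup>2) * (1 + u\<^sup>2) powr (- \<beta>)) \<partial>lborel)"
        unfolding B_def cauchy_line_def rel_ent_def
        by (subst nn_integral_density) (auto simp: ennreal_mult'[symmetric] mult.commute)
      also note c(2)
      also have "(\<integral>\<^sup>+u. ennreal ((g (Y (v, u)) \<bullet> j * \<sigma> v)\<^sup>2 * ((1 + u\<^sup>2) * ln (exp 1 + u\<^sup>2)) * (1 + u\<^sup>2) powr (- \<beta>)) \<partial>lborel)
        = (\<integral>\<^sup>+u. ennreal ((g (Y (v, u)) \<bullet> j * \<sigma> v)\<^sup>2 * ((1 + u\<^sup>2) * ln (exp 1 + u\<^sup>2))) \<partial>B)"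
        unfolding B_def cauchy_line_def
        by (subst nn_integral_density) (auto simp: ennreal_mult'[symmetric] mult.commute)
      also have "ennreal C2 * \<dots> \<le> RB v"
        unfolding RB_def \<sigma>_def Rz
        by (intro mult_left_mono nn_integral_mono ennreal_leI coords_gradient_bound(2) I(1)) simp
      finally show ?thesis using c(1) by auto
    qed
    have "\<exists>c>0. (\<integral>\<^sup>+z. ennreal (rel_ent c ((f (Y z))\<^sup>2)) \<partial>(A \<Otimes>\<^sub>M B)) \<le> (\<integral>\<^sup>+u. RA u \<partial>B) + (\<integral>\<^sup>+v. RB v \<partial>A)"
      using lsiA lsiB e bd fpos
      by (intro rel_ent_tensor[OF finA finB, where e = "e\<^sup>2" and K = "K\<^sup>2"])
        (auto intro!: power_mono simp: less_imp_le)
    then obtain c where c: "c > 0" "(\<integral>\<^sup>+z. ennreal (rel_ent c ((f (Y z))\<^sup>2)) \<partial>(A \<Otimes>\<^sub>M B)) \<le> (\<integral>\<^sup>+u. RA u \<partial>B) + (\<integral>\<^sup>+v. RB v \<partial>A)"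
      by auto
    have "(\<integral>\<^sup>+v. ennreal (rel_ent c ((f (vec_of (insert j I) v))\<^sup>2)) \<partial>cauchy_coords (insert j I) \<beta>)
      = (\<integral>\<^sup>+z. ennreal (rel_ent c ((f (Y z))\<^sup>2)) \<partial>(A \<Otimes>\<^sub>M B))"
      unfolding A_def B_def Y_def
      by (rule nn_integral_cauchy_coords_insert[OF I \<beta>]) (simp add: rel_ent_def)
    also note c(2)
    also have "(\<integral>\<^sup>+u. RA u \<partial>B) = ennreal (2 * C1) * (\<integral>\<^sup>+z. ennreal (R (insert_coord I j z)) \<partial>(A \<Otimes>\<^sub>M B))"
      unfolding RA_def by (subst P.nn_integral_snd[symmetric]) (auto intro!: nn_integral_cmult)
    also have "(\<integral>\<^sup>+v. RB v \<partial>A) = ennreal C2 * (\<integral>\<^sup>+z. ennreal (R (insert_coord I j z)) \<partial>(A \<Otimes>\<^sub>M B))"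
      unfolding RB_def by (subst B.nn_integral_fst[symmetric]) (auto intro!: nn_integral_cmult)
    also have "ennreal (2 * C1) * (\<integral>\<^sup>+z. ennreal (R (insert_coord I j z)) \<partial>(A \<Otimes>\<^sub>M B))
        + ennreal C2 * (\<integral>\<^sup>+z. ennreal (R (insert_coord I j z)) \<partial>(A \<Otimes>\<^sub>M B))
        = ennreal (2 * C1 + C2) * (\<integral>\<^sup>+z. ennreal (R (insert_coord I j z)) \<partial>(A \<Otimes>\<^sub>M B))"
      using C1 C2 by (simp add: distrib_right[symmetric] ennreal_plus[symmetric] del: ennreal_plus)
    \<comment> \<open>The change of variables is undone on the energy side; the entropy side was
      rewritten in the same way at the start of the chain.\<close>
    also have "(\<integral>\<^sup>+z. ennreal (R (insert_coord I j z)) \<partial>(A \<Otimes>\<^sub>M B)) = (\<integral>\<^sup>+v. ennreal (R v) \<partial>cauchy_coords (insert j I) \<beta>)"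
      unfolding A_def B_def by (rule nn_integral_cauchy_coords_insert[OF I \<beta>, symmetric]) simp
    finally show ?thesis using c(1) unfolding R_def by auto
  qed
  show ?case
  proof (rule exI[of _ "2 * C1 + C2"], intro conjI allI impI)
    show "0 < 2 * C1 + C2" using C1 C2 by simp
  qed (rule step; (erule spec | assumption))
qed

section \<open>The Cauchy measure on Euclidean space\<close>

definition cauchy_unnormalized :: "real \<Rightarrow> 'a::euclidean_space measure" where
  "cauchy_unnormalized \<beta> = density lborel (\<lambda>x. ennreal ((1 + (norm x)\<^sup>2) powr (- \<beta>)))"

lemma norm_vec_of_Basis: "(norm (vec_of Basis v :: 'a::euclidean_space))\<^sup>2 = sq_sum Basis v"
  unfolding power2_norm_eq_inner euclidean_inner[of "vec_of Basis v" "vec_of Basis v"] sq_sum_def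
  by (intro sum.cong) (auto simp: inner_vec_of power2_eq_square)

text \<open>Lebesgue measure is the image under \<open>vec_of Basis\<close> of the product over the
  basis, and the norm squared becomes \<open>sq_sum\<close>.\<close>

lemma nn_integral_cauchy_unnormalized:
  fixes h :: "'a::euclidean_space \<Rightarrow> ennreal"
  assumes [measurable]: "h \<in> borel_measurable borel"
  shows "(\<integral>\<^sup>+x. h x \<partial>cauchy_unnormalized \<beta>) = (\<integral>\<^sup>+v. h (vec_of Basis v) \<partial>cauchy_coords Basis \<beta>)"
proof -
  have "(\<integral>\<^sup>+x. h x \<partial>cauchy_unnormalized \<beta>) = (\<integral>\<^sup>+x. ennreal ((1 + (norm x)\<^sup>2) powr (- \<beta>)) * h x \<partial>lborel)"
    unfolding cauchy_unnormalized_def by (intro nn_integral_density) measurable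
  also have "\<dots> = (\<integral>\<^sup>+x. ennreal ((1 + (norm x)\<^sup>2) powr (- \<beta>)) * h x \<partial>distr (\<Pi>\<^sub>M b\<in>Basis. lborel) borel (vec_of Basis))"
    unfolding vec_of_def[abs_def] by (rule arg_cong[OF lborel_eq])
  also have "\<dots> = (\<integral>\<^sup>+v. ennreal ((1 + (norm (vec_of Basis v :: 'a))\<^sup>2) powr (- \<beta>)) * h (vec_of Basis v) \<partial>(\<Pi>\<^sub>M b\<in>Basis. lborel))"
    by (subst nn_integral_distr) auto
  also have "\<dots> = (\<integral>\<^sup>+v. h (vec_of Basis v) \<partial>cauchy_coords Basis \<beta>)"
    unfolding cauchy_coords_def norm_vec_of_Basis by (intro nn_integral_density[symmetric]) measurable
  finally show ?thesis .
qed

lemma finite_cauchy_unnormalized: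
  assumes "\<beta> > real DIM('a::euclidean_space) / 2"
  shows "finite_measure (cauchy_unnormalized \<beta> :: 'a measure)"
proof -
  interpret finite_measure "cauchy_coords (Basis :: 'a set) \<beta>"
    using assms by (intro finite_cauchy_coords) auto
  have "emeasure (cauchy_unnormalized \<beta> :: 'a measure) (space (cauchy_unnormalized \<beta>))
      = (\<integral>\<^sup>+x. 1 \<partial>(cauchy_unnormalized \<beta> :: 'a measure))" by simp
  also have "\<dots> = (\<integral>\<^sup>+v. 1 \<partial>cauchy_coords (Basis :: 'a set) \<beta>)"
    by (rule nn_integral_cauchy_unnormalized) simp
  also have "\<dots> < \<infinity>" by (simp add: emeasure_finite less_top[symmetric])
  finally show ?thesis by (intro finite_measureI) simp
qed

lemma cauchy_unnormalized_lsi: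
  assumes "\<beta> > real DIM('a::euclidean_space) / 2"
  shows "\<exists>C>0. \<forall>f (g :: 'a \<Rightarrow> 'a) e K. (\<forall>x. (f has_derivative (\<lambda>h. g x \<bullet> h)) (at x)) \<longrightarrow> continuous_on UNIV g \<longrightarrow>
      e > 0 \<longrightarrow> (\<forall>x. e \<le> f x) \<longrightarrow> (\<forall>x. f x \<le> K) \<longrightarrow>
    (\<exists>c>0. (\<integral>\<^sup>+x. ennreal (rel_ent c ((f x)\<^sup>2)) \<partial>cauchy_unnormalized \<beta>)
      \<le> ennreal C * (\<integral>\<^sup>+x. ennreal ((norm (g x))\<^sup>2 * ((1 + (norm x)\<^sup>2) * ln (exp 1 + (norm x)\<^sup>2))) \<partial>cauchy_unnormalized \<beta>))"
proof -
  obtain C where C: "C > 0" and lsi: "\<forall>f (g :: 'a \<Rightarrow> 'a) e K. (\<forall>x. (f has_derivative (\<lambda>h. g x \<bullet> h)) (at x)) \<longrightarrow> continuous_on UNIV g \<longrightarrow>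
      e > 0 \<longrightarrow> (\<forall>x. e \<le> f x) \<longrightarrow> (\<forall>x. f x \<le> K) \<longrightarrow>
    (\<exists>c>0. (\<integral>\<^sup>+v. ennreal (rel_ent c ((f (vec_of Basis v))\<^sup>2)) \<partial>cauchy_coords Basis \<beta>)
      \<le> ennreal C * (\<integral>\<^sup>+v. ennreal ((\<Sum>b\<in>Basis. (g (vec_of Basis v) \<bullet> b)\<^sup>2)
          * ((1 + sq_sum Basis v) * ln (exp 1 + sq_sum Basis v))) \<partial>cauchy_coords Basis \<beta>))"
    using cauchy_coords_lsi[of "Basis :: 'a set" \<beta>, OF finite_Basis subset_refl assms] by (elim exE conjE) (rule that)
  have "\<exists>c>0. (\<integral>\<^sup>+x. ennreal (rel_ent c ((f x)\<^sup>2)) \<partial>cauchy_unnormalized \<beta>)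
      \<le> ennreal C * (\<integral>\<^sup>+x. ennreal ((norm (g x))\<^sup>2 * ((1 + (norm x)\<^sup>2) * ln (exp 1 + (norm x)\<^sup>2))) \<partial>cauchy_unnormalized \<beta>)"
    if f: "\<forall>x. (f has_derivative (\<lambda>h. g x \<bullet> h)) (at x)" and g: "continuous_on UNIV g"
      and b: "e > 0" "\<forall>x. e \<le> f x" "\<forall>x. f x \<le> K" for f and g :: "'a \<Rightarrow> 'a" and e K
  proof -
    have "continuous_on UNIV f"
      using f by (meson continuous_at_imp_continuous_on has_derivative_continuous)
    then have [measurable]: "f \<in> borel_measurable borel" "g \<in> borel_measurable borel"
      using g by (auto intro: borel_measurable_continuous_onI)
    have sq: "(\<Sum>b\<in>Basis. (x \<bullet> b)\<^sup>2) = (norm x)\<^sup>2" for x :: 'a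
      unfolding power2_norm_eq_inner euclidean_inner[of x x] by (simp add: power2_eq_square)
    obtain c where c: "c > 0" "(\<integral>\<^sup>+v. ennreal (rel_ent c ((f (vec_of Basis v))\<^sup>2)) \<partial>cauchy_coords Basis \<beta>)
      \<le> ennreal C * (\<integral>\<^sup>+v. ennreal ((norm (g (vec_of Basis v)))\<^sup>2
          * ((1 + (norm (vec_of Basis v :: 'a))\<^sup>2) * ln (exp 1 + (norm (vec_of Basis v :: 'a))\<^sup>2))) \<partial>cauchy_coords Basis \<beta>)"
      using lsi[rule_format, OF f[rule_format] g b(1) b(2,3)[rule_format]] unfolding sq norm_vec_of_Basis by auto
    show ?thesis
      using c by (subst (1 2) nn_integral_cauchy_unnormalized) (auto simp: rel_ent_def)
  qed
  then show ?thesis using C by blast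
qed

section \<open>From the divergence to \<open>Ent\<close>, and approximation by positive
  functions\<close>

text \<open>On a probability space \<open>g - m\<close> integrates to 0, so \<open>Ent\<close> is
  the integral of \<open>rel_ent m g\<close> at the mean \<open>m\<close>, and the mean is the
  minimiser.\<close>

lemma (in finite_measure) Ent_le_rel_ent:
  fixes g :: "'a \<Rightarrow> real"
  assumes [measurable]: "g \<in> borel_measurable M" and e: "0 < e" and bd: "\<And>x. e \<le> g x" "\<And>x. g x \<le> K"
    and one: "measure M (space M) = 1" and c: "c > 0"
  shows "ennreal (Ent M g) \<le> (\<integral>\<^sup>+x. ennreal (rel_ent c (g x)) \<partial>M)"
proof -
  define m where "m = (\<integral>x. g x \<partial>M)"
  note mean = rel_ent_mean[OF assms(1) e bd _ c, unfolded one, simplified, folded m_def]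
  have m: "m > 0" using mean(1) e by simp
  have gpos: "g x > 0" for x using e bd(1)[of x] by simp
  have intg: "integrable M g"
    using gpos bd(2) by (intro integrable_const_bound[of _ K]) (auto intro!: AE_I2 simp: abs_of_pos)
  have intr: "integrable M (\<lambda>x. rel_ent m (g x))"
    using rel_ent_bound[OF e _ _ m] bd
    by (intro integrable_const_bound[of _ "K\<^sup>2 / m + m"]) (auto intro!: AE_I2 simp: rel_ent_def)
  have "Ent M g = (\<integral>x. rel_ent m (g x) + (g x - m) \<partial>M)"
    unfolding Ent_def m_def[symmetric] by (simp add: rel_ent_def)
  also have "\<dots> = (\<integral>x. rel_ent m (g x) \<partial>M)"
    using intr intg one by (simp add: m_def)
  also have "ennreal \<dots> \<le> (\<integral>\<^sup>+x. ennreal (rel_ent m (g x)) \<partial>M)"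
    by (rule ennreal_integral_le_nn_integral[OF intr])
  also have "\<dots> \<le> (\<integral>\<^sup>+x. ennreal (rel_ent c (g x)) \<partial>M)"
    unfolding mean(3) by simp
  finally show ?thesis .
qed

lemma abs_mult_ln_le: "t > 0 \<Longrightarrow> \<bar>t * ln t\<bar> \<le> 1 + t\<^sup>2" for t :: real
proof -
  assume t: "t > 0"
  have "ln t \<le> t" using ln_le_minus_one[OF t] by simp
  then have 1: "t * ln t \<le> t\<^sup>2" using t by (simp add: power2_eq_square)
  have "ln (1 / t) \<le> 1 / t" using ln_le_minus_one[of "1 / t"] t by simp
  then have "t * ln (1 / t) \<le> t * (1 / t)" using t by (intro mult_left_mono) auto
  then have 2: "- (t * ln t) \<le> 1" using t by (simp add: ln_div)
  have "0 \<le> t\<^sup>2" by simp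
  with 1 2 show ?thesis unfolding abs_le_iff by linarith
qed

text \<open>Dominated convergence, making functions with zeros accessible from strictly positive
  ones. The positive mean keeps the ratios inside the logarithm bounded.\<close>

lemma (in finite_measure) Ent_shift_tendsto:
  fixes g :: "'a \<Rightarrow> real"
  assumes [measurable]: "g \<in> borel_measurable M" and bd: "\<And>x. 0 \<le> g x" "\<And>x. g x \<le> K"
    and one: "measure M (space M) = 1" and m: "(\<integral>x. g x \<partial>M) > 0"
  shows "(\<lambda>n. Ent M (\<lambda>x. g x + 1 / real (Suc n))) \<longlonglongrightarrow> Ent M g"
proof -
  define m where "m = (\<integral>x. g x \<partial>M)"
  have mpos: "m > 0" using m unfolding m_def .
  define d where "d n = 1 / real (Suc n)" for n
  have d: "d n > 0" "d n \<le> 1" for n unfolding d_def by auto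
  have d0: "d \<longlonglongrightarrow> 0" unfolding d_def by (rule LIMSEQ_Suc[OF lim_1_over_n])
  have intg: "integrable M g"
    using bd by (intro integrable_const_bound[of _ K]) (auto intro!: AE_I2)
  have mn: "(\<integral>x. g x + d n \<partial>M) = m + d n" for n
    using intg one by (simp add: m_def)
  \<comment> \<open>The integrand is \<open>(m + d n) * (t * ln t)\<close> with
    \<open>0 < t <= (K + 1) / m\<close>, and \<open>abs_mult_ln_le\<close> bounds it by
    \<open>B\<close>.\<close>
  define B where "B = (m + 1) * (1 + ((K + 1) / m)\<^sup>2)"
  have "(\<lambda>n. \<integral>x. (g x + d n) * ln ((g x + d n) / (m + d n)) \<partial>M) \<longlonglongrightarrow> (\<integral>x. g x * ln (g x / m) \<partial>M)"
  proof (rule integral_dominated_convergence[where w = "\<lambda>_. B"])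
    show "AE x in M. (\<lambda>n. (g x + d n) * ln ((g x + d n) / (m + d n))) \<longlonglongrightarrow> g x * ln (g x / m)"
    proof (rule AE_I2)
      fix x
      show "(\<lambda>n. (g x + d n) * ln ((g x + d n) / (m + d n))) \<longlonglongrightarrow> g x * ln (g x / m)"
      proof (cases "g x = 0")
        case False
        then have "g x > 0" using bd(1)[of x] by simp
        then have "(\<lambda>n. (g x + d n) * ln ((g x + d n) / (m + d n))) \<longlonglongrightarrow> (g x + 0) * ln ((g x + 0) / (m + 0))"
          using mpos by (intro tendsto_intros d0) auto
        then show ?thesis by simp
      next
        case True
        \<comment> \<open>At a zero of \<open>g\<close> the limit value is 0 because its factor
          \<open>g x\<close> is 0; the approximants also tend to 0, since \<open>ln n / n\<close>
          does.\<close>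
        have "(\<lambda>n. - (ln (real (Suc n)) / real (Suc n)) - d n * ln (m + d n)) \<longlonglongrightarrow> - 0 - 0 * ln (m + 0)"
          using mpos by (intro tendsto_intros d0 LIMSEQ_Suc[OF lim_ln_over_n]) auto
        moreover have "d n * ln (d n / (m + d n)) = - (ln (real (Suc n)) / real (Suc n)) - d n * ln (m + d n)" for n
        proof -
          have "ln (d n / (m + d n)) = - ln (real (Suc n)) - ln (m + d n)"
          proof -
            have "ln (d n / (m + d n)) = ln (d n) - ln (m + d n)"
              using d(1)[of n] add_pos_pos[OF mpos d(1)[of n]] by (simp add: ln_div)
            moreover have "ln (d n) = - ln (real (Suc n))"
              unfolding d_def by (simp add: ln_div del: of_nat_Suc)
            ultimately show ?thesis by simp
          qed
          then show ?thesis by (simp add: d_def right_diff_distrib del: of_nat_Suc)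
        qed
        ultimately show ?thesis using True by simp
      qed
    qed
    show "AE x in M. norm ((g x + d n) * ln ((g x + d n) / (m + d n))) \<le> B" for n
    proof (rule AE_I2)
      fix x
      define t where "t = (g x + d n) / (m + d n)"
      have mp: "m + d n > 0" using mpos d(1)[of n] by simp
      have t: "t > 0" using bd(1)[of x] d(1)[of n] mp unfolding t_def by (intro divide_pos_pos) auto
      have "t \<le> (K + 1) / m"
        unfolding t_def using bd(1)[of x] bd(2)[of x] d[of n] mpos by (intro frac_le) auto
      then have tt: "t\<^sup>2 \<le> ((K + 1) / m)\<^sup>2" using t by (intro power_mono) auto
      have "norm ((g x + d n) * ln ((g x + d n) / (m + d n))) = (m + d n) * \<bar>t * ln t\<bar>"
        using mp unfolding t_def by (simp add: abs_mult)
      also have "\<dots> \<le> (m + 1) * (1 + t\<^sup>2)"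
        using abs_mult_ln_le[OF t] mp d[of n] by (intro mult_mono) auto
      also have "\<dots> \<le> B" unfolding B_def using tt mpos by (intro mult_left_mono) auto
      finally show "norm ((g x + d n) * ln ((g x + d n) / (m + d n))) \<le> B" .
    qed
  qed auto
  then show ?thesis unfolding Ent_def d_def[symmetric] mn m_def[symmetric] .
qed

section \<open>Gradients of smooth functions and the normalizing constant\<close>

text \<open>By linearity of the Frechet derivative the gradient is assembled from its values on the
  basis, each of which is continuous by \<open>Ck\<close>.\<close>

lemma smooth_gradient:
  fixes f :: "'a::euclidean_space \<Rightarrow> real"
  assumes "smooth f"
  shows "(f has_derivative (\<lambda>h. gradient f x \<bullet> h)) (at x)" "continuous_on UNIV (gradient f)"
proof -
  have "Ck (Suc 0) f" using assms unfolding smooth_def by blast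
  then have d: "\<And>x. f differentiable at x" and c: "\<And>v. continuous_on UNIV (\<lambda>x. frechet_derivative f (at x) v)"
    by auto
  define D where "D x = (\<Sum>b\<in>Basis. frechet_derivative f (at x) b *\<^sub>R b)" for x
  have G: "GDERIV f x :> D x" for x
  proof -
    have f': "(f has_derivative frechet_derivative f (at x)) (at x)"
      using d frechet_derivative_works by blast
    then interpret linear "frechet_derivative f (at x)" by (rule has_derivative_linear)
    have "frechet_derivative f (at x) h = h \<bullet> D x" for h
    proof -
      have "frechet_derivative f (at x) h = frechet_derivative f (at x) (\<Sum>b\<in>Basis. (h \<bullet> b) *\<^sub>R b)"
        by (simp add: euclidean_representation)
      also have "\<dots> = h \<bullet> D x" unfolding D_def sum scale inner_sum_right by (simp add: mult.commute)
      finally show ?thesis .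
    qed
    then have "frechet_derivative f (at x) = (\<lambda>h. h \<bullet> D x)" by auto
    then show ?thesis using f' unfolding gderiv_def by simp
  qed
  have gD: "gradient f = D" using gradient_eq[OF G] by auto
  show "(f has_derivative (\<lambda>h. gradient f x \<bullet> h)) (at x)"
    using G[of x] unfolding gD gderiv_def by (simp add: inner_commute)
  show "continuous_on UNIV (gradient f)"
    unfolding gD D_def by (intro continuous_intros c)
qed

lemma nn_integral_cauchy_measure:
  fixes h :: "real ^ 'n \<Rightarrow> ennreal"
  assumes [measurable]: "h \<in> borel_measurable borel" and "cauchy_Z TYPE('n) \<beta> > 0"
  shows "(\<integral>\<^sup>+x. h x \<partial>cauchy_measure \<beta>) = ennreal (1 / cauchy_Z TYPE('n) \<beta>) * (\<integral>\<^sup>+x. h x \<partial>cauchy_unnormalized \<beta>)"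
proof -
  let ?Z = "cauchy_Z TYPE('n) \<beta>"
  have "(\<integral>\<^sup>+x. h x \<partial>cauchy_measure \<beta>) = (\<integral>\<^sup>+x. ennreal ((1 + (norm x)\<^sup>2) powr (- \<beta>) / ?Z) * h x \<partial>lborel)"
    unfolding cauchy_measure_def by (intro nn_integral_density) measurable
  also have "\<dots> = (\<integral>\<^sup>+x. ennreal (1 / ?Z) * (ennreal ((1 + (norm x)\<^sup>2) powr (- \<beta>)) * h x) \<partial>lborel)"
    using assms(2) by (intro nn_integral_cong) (simp add: mult.assoc[symmetric] ennreal_mult'[symmetric])
  also have "\<dots> = ennreal (1 / ?Z) * (\<integral>\<^sup>+x. ennreal ((1 + (norm x)\<^sup>2) powr (- \<beta>)) * h x \<partial>lborel)"
    by (intro nn_integral_cmult) measurable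
  also have "(\<integral>\<^sup>+x. ennreal ((1 + (norm x)\<^sup>2) powr (- \<beta>)) * h x \<partial>lborel) = (\<integral>\<^sup>+x. h x \<partial>cauchy_unnormalized \<beta>)"
    unfolding cauchy_unnormalized_def by (intro nn_integral_density[symmetric]) measurable
  finally show ?thesis .
qed

text \<open>Finite total mass makes the density integrable, so the Bochner integral
  \<open>cauchy_Z\<close> is a true integral rather than a default 0. It is positive since a
  strictly positive density cannot vanish almost everywhere.\<close>

lemma cauchy_Z:
  assumes "\<beta> > real CARD('n::finite) / 2"
  shows "cauchy_Z TYPE('n) \<beta> > 0"
    and "emeasure (cauchy_unnormalized \<beta> :: (real ^ 'n) measure) UNIV = ennreal (cauchy_Z TYPE('n) \<beta>)"
proof -
  let ?w = "\<lambda>x :: real ^ 'n. (1 + (norm x)\<^sup>2) powr (- \<beta>)"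
  have pos: "?w x > 0" for x by (simp add: add_pos_nonneg less_imp_neq[THEN not_sym])
  interpret finite_measure "cauchy_unnormalized \<beta> :: (real ^ 'n) measure"
    using assms by (intro finite_cauchy_unnormalized) simp
  have em: "emeasure (cauchy_unnormalized \<beta> :: (real ^ 'n) measure) UNIV = (\<integral>\<^sup>+x. ennreal (?w x) \<partial>lborel)"
    unfolding cauchy_unnormalized_def by (simp add: emeasure_density)
  have fin: "(\<integral>\<^sup>+x. ennreal (?w x) \<partial>lborel) < \<infinity>"
    using emeasure_finite[of UNIV] unfolding em by (simp add: less_top)
  have int: "integrable lborel ?w"
    using fin by (intro integrableI_nonneg) auto
  show "emeasure (cauchy_unnormalized \<beta> :: (real ^ 'n) measure) UNIV = ennreal (cauchy_Z TYPE('n) \<beta>)"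
    unfolding em cauchy_Z_def using int by (intro nn_integral_eq_integral) auto
  have "cauchy_Z TYPE('n) \<beta> \<noteq> 0"
  proof
    assume "cauchy_Z TYPE('n) \<beta> = 0"
    then have "AE x in lborel. ?w x = 0"
      unfolding cauchy_Z_def using integral_nonneg_eq_0_iff_AE[OF int] by auto
    then have "AE x in (lborel :: (real ^ 'n) measure). False"
      by eventually_elim (use pos in \<open>auto simp: less_imp_neq[THEN not_sym]\<close>)
    then have "emeasure (lborel :: (real ^ 'n) measure) (space lborel) = 0"
      unfolding ae_filter_eq_bot_iff[symmetric] trivial_limit_def[symmetric] by simp
    then show False by (simp add: emeasure_lborel_UNIV)
  qed
  moreover have "cauchy_Z TYPE('n) \<beta> \<ge> 0" unfolding cauchy_Z_def by simp
  ultimately show "cauchy_Z TYPE('n) \<beta> > 0" by simp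
qed

text \<open>The energy is an extended nonnegative integral, so infinite energy is represented as
  infinity and not by a default value. Boundedness of \<open>f\<close> makes the integral in
  \<open>Ent\<close> finite.\<close>

theorem corollary2p9:
  fixes \<beta> :: real
  assumes "\<beta> > real CARD('n::finite) / 2"
  shows "\<exists>C::real. C > 0 \<and>
    (\<forall>f :: real ^ 'n \<Rightarrow> real. smooth f \<longrightarrow> bounded (range f) \<longrightarrow>
      ennreal (Ent (cauchy_measure \<beta>) (\<lambda>x. (f x)\<^sup>2)) \<le>
        ennreal C * (\<integral>\<^sup>+ x. ennreal ((norm (gradient f x))\<^sup>2 * (1 + (norm x)\<^sup>2) * ln (exp 1 + (norm x)\<^sup>2))
                      \<partial>cauchy_measure \<beta>))"
proof -
  define \<mu> where "\<mu> = (cauchy_measure \<beta> :: (real ^ 'n) measure)"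
  define Z where "Z = cauchy_Z TYPE('n) \<beta>"
  have Z: "Z > 0" unfolding Z_def by (rule cauchy_Z[OF assms])
  note nn = nn_integral_cauchy_measure[OF _ Z[unfolded Z_def], folded Z_def \<mu>_def]
  have sp: "space \<mu> = UNIV" and [measurable_cong]: "sets \<mu> = sets borel"
    unfolding \<mu>_def cauchy_measure_def by auto
  have em: "emeasure \<mu> (space \<mu>) = 1"
  proof -
    have "emeasure \<mu> (space \<mu>) = (\<integral>\<^sup>+x. 1 \<partial>\<mu>)" by simp
    also have "\<dots> = ennreal (1 / Z) * (\<integral>\<^sup>+x. 1 \<partial>(cauchy_unnormalized \<beta> :: (real ^ 'n) measure))"
      by (rule nn) simp
    also have "(\<integral>\<^sup>+x. 1 \<partial>(cauchy_unnormalized \<beta> :: (real ^ 'n) measure)) = ennreal Z"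
      using cauchy_Z(2)[OF assms] unfolding Z_def by (simp add: cauchy_unnormalized_def)
    finally show ?thesis using Z by (simp add: ennreal_mult'[symmetric])
  qed
  interpret finite_measure \<mu> by (rule finite_measureI) (simp add: em)
  have one: "measure \<mu> (space \<mu>) = 1" using em unfolding measure_def by simp
  have DIM: "\<beta> > real DIM(real ^ 'n) / 2" using assms by simp
  obtain C where C: "C > 0" and lsi: "\<forall>f (g :: real ^ 'n \<Rightarrow> real ^ 'n) e K. (\<forall>x. (f has_derivative (\<lambda>h. g x \<bullet> h)) (at x)) \<longrightarrow> continuous_on UNIV g \<longrightarrow>
      e > 0 \<longrightarrow> (\<forall>x. e \<le> f x) \<longrightarrow> (\<forall>x. f x \<le> K) \<longrightarrow>
    (\<exists>c>0. (\<integral>\<^sup>+x. ennreal (rel_ent c ((f x)\<^sup>2)) \<partial>cauchy_unnormalized \<beta>)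
      \<le> ennreal C * (\<integral>\<^sup>+x. ennreal ((norm (g x))\<^sup>2 * ((1 + (norm x)\<^sup>2) * ln (exp 1 + (norm x)\<^sup>2))) \<partial>cauchy_unnormalized \<beta>))"
    using cauchy_unnormalized_lsi[OF DIM] by (elim exE conjE) (rule that)
  have "ennreal (Ent \<mu> (\<lambda>x. (f x)\<^sup>2)) \<le>
        ennreal C * (\<integral>\<^sup>+ x. ennreal ((norm (gradient f x))\<^sup>2 * (1 + (norm x)\<^sup>2) * ln (exp 1 + (norm x)\<^sup>2)) \<partial>\<mu>)"
    if f: "smooth f" and bdd: "bounded (range f)" for f :: "real ^ 'n \<Rightarrow> real"
  proof -
    note f' = smooth_gradient[OF f]
    have contf: "continuous_on UNIV f"
      using f'(1) by (meson continuous_at_imp_continuous_on has_derivative_continuous)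
    have [measurable]: "f \<in> borel_measurable borel" "gradient f \<in> borel_measurable borel"
      using contf f'(2) by (auto intro: borel_measurable_continuous_onI)
    obtain K where K: "\<And>x. \<bar>f x\<bar> \<le> K" using bdd unfolding bounded_iff by auto
    have fK: "(f x)\<^sup>2 \<le> K\<^sup>2" for x using K[of x] by (metis abs_ge_zero power2_abs power_mono)
    define w where "w x = (1 + (norm x)\<^sup>2) * ln (exp 1 + (norm x)\<^sup>2)" for x :: "real ^ 'n"
    have w: "w x \<ge> 0" for x
      unfolding w_def by (intro mult_nonneg_nonneg ln_ge_zero) (auto simp: add_increasing2)
    have [measurable]: "w \<in> borel_measurable borel" unfolding w_def by measurable
    define J where "J = (\<integral>\<^sup>+ x. ennreal ((norm (gradient f x))\<^sup>2 * w x) \<partial>\<mu>)"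
    \<comment> \<open>The inequality for positive functions is applied to
      \<open>F = sqrt (f^2 + \<epsilon>)\<close>, which is bounded below by
      \<open>sqrt \<epsilon>\<close>. Its gradient \<open>G\<close> is that of \<open>f\<close>
      multiplied by \<open>f / F\<close>, a factor of modulus at most 1.\<close>
    have approx: "ennreal (Ent \<mu> (\<lambda>x. (f x)\<^sup>2 + \<epsilon>)) \<le> ennreal C * J" if \<epsilon>: "\<epsilon> > 0" for \<epsilon>
    proof -
      have pos: "(f x)\<^sup>2 + \<epsilon> > 0" for x using \<epsilon> by (simp add: add_nonneg_pos)
      define F where "F x = sqrt ((f x)\<^sup>2 + \<epsilon>)" for x
      define G where "G x = (f x / F x) *\<^sub>R gradient f x" for x
      have F: "F x > 0" "(F x)\<^sup>2 = (f x)\<^sup>2 + \<epsilon>" for x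
        using pos[of x] unfolding F_def by (auto simp: less_imp_le)
      have dF: "(F has_derivative (\<lambda>h. G x \<bullet> h)) (at x)" for x
      proof -
        have "((\<lambda>x. (f x)\<^sup>2 + \<epsilon>) has_derivative (\<lambda>h. 2 * f x * (gradient f x \<bullet> h))) (at x)"
          by (auto intro!: derivative_eq_intros f'(1))
        from has_derivative_real_sqrt[OF pos this]
        show ?thesis unfolding G_def F_def[abs_def] by (simp add: field_simps)
      qed
      have contF: "continuous_on UNIV F" unfolding F_def by (intro continuous_intros contf)
      have cG: "continuous_on UNIV G"
        unfolding G_def by (intro continuous_intros contf contF f'(2)) (use F(1) in \<open>auto simp: less_imp_neq[THEN not_sym]\<close>)
      have [measurable]: "F \<in> borel_measurable borel" "G \<in> borel_measurable borel"
        using contF cG by (auto intro: borel_measurable_continuous_onI)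
      have eF: "sqrt \<epsilon> \<le> F x" "F x \<le> sqrt (K\<^sup>2 + \<epsilon>)" for x
        unfolding F_def using fK[of x] by auto
      have Gle: "(norm (G x))\<^sup>2 \<le> (norm (gradient f x))\<^sup>2" for x
      proof -
        have "(f x)\<^sup>2 / (F x)\<^sup>2 \<le> 1" using F[of x] \<epsilon> pos[of x] by simp
        then have "(f x)\<^sup>2 / (F x)\<^sup>2 * (norm (gradient f x))\<^sup>2 \<le> 1 * (norm (gradient f x))\<^sup>2"
          by (intro mult_right_mono) auto
        then show ?thesis unfolding G_def by (simp add: power_mult_distrib power_divide)
      qed
      obtain c where c: "c > 0" "(\<integral>\<^sup>+x. ennreal (rel_ent c ((F x)\<^sup>2)) \<partial>cauchy_unnormalized \<beta>)
        \<le> ennreal C * (\<integral>\<^sup>+x. ennreal ((norm (G x))\<^sup>2 * w x) \<partial>cauchy_unnormalized \<beta>)"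
        using lsi[rule_format, of F G "sqrt \<epsilon>", OF dF cG _ eF] \<epsilon> unfolding w_def by auto
      have "ennreal (Ent \<mu> (\<lambda>x. (f x)\<^sup>2 + \<epsilon>)) \<le> (\<integral>\<^sup>+x. ennreal (rel_ent c ((f x)\<^sup>2 + \<epsilon>)) \<partial>\<mu>)"
        using \<epsilon> fK by (intro Ent_le_rel_ent[where e = \<epsilon> and K = "K\<^sup>2 + \<epsilon>"] one c(1)) auto
      also have "\<dots> = ennreal (1 / Z) * (\<integral>\<^sup>+x. ennreal (rel_ent c ((F x)\<^sup>2)) \<partial>cauchy_unnormalized \<beta>)"
        unfolding F(2) by (rule nn) (simp add: rel_ent_def)
      also have "\<dots> \<le> ennreal (1 / Z) * (ennreal C * (\<integral>\<^sup>+x. ennreal ((norm (G x))\<^sup>2 * w x) \<partial>cauchy_unnormalized \<beta>))"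
        by (intro mult_left_mono c(2)) simp
      \<comment> \<open>The normalizing factor \<open>1 / Z\<close> appears on both sides, so
        \<open>C\<close> carries over unchanged.\<close>
      also have "\<dots> = ennreal C * (\<integral>\<^sup>+x. ennreal ((norm (G x))\<^sup>2 * w x) \<partial>\<mu>)"
        by (subst nn) (auto simp: mult_ac)
      also have "\<dots> \<le> ennreal C * J"
        unfolding J_def by (intro mult_left_mono nn_integral_mono ennreal_leI mult_right_mono Gle w) simp
      finally show ?thesis .
    qed
    have "ennreal (Ent \<mu> (\<lambda>x. (f x)\<^sup>2)) \<le> ennreal C * J"
    proof (cases "(\<integral>x. (f x)\<^sup>2 \<partial>\<mu>) > 0")
      case True
      have "(\<lambda>n. Ent \<mu> (\<lambda>x. (f x)\<^sup>2 + 1 / real (Suc n))) \<longlonglongrightarrow> Ent \<mu> (\<lambda>x. (f x)\<^sup>2)"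
        by (rule Ent_shift_tendsto[OF _ _ fK one True]) auto
      then have "(\<lambda>n. ennreal (Ent \<mu> (\<lambda>x. (f x)\<^sup>2 + 1 / real (Suc n)))) \<longlonglongrightarrow> ennreal (Ent \<mu> (\<lambda>x. (f x)\<^sup>2))"
        by (rule tendsto_ennrealI)
      then show ?thesis by (rule LIMSEQ_le_const2) (auto intro!: approx)
    next
      case False
      moreover have "(\<integral>x. (f x)\<^sup>2 \<partial>\<mu>) \<ge> 0" by simp
      ultimately have "(\<integral>x. (f x)\<^sup>2 \<partial>\<mu>) = 0" by linarith
      \<comment> \<open>With mean 0 the quotient in \<open>Ent\<close> is a division by 0, so the
        logarithm is \<open>ln 0 = 0\<close> and the entropy is 0.\<close>
      then show ?thesis by (simp add: Ent_def)
    qed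
    then show ?thesis unfolding J_def w_def by (simp add: mult.assoc)
  qed
  then show ?thesis using C unfolding \<mu>_def by blast
qed

end
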